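(* Let $X$ be a symmetrically regular complex Banach space. Then $\mathcal G_0(B_X)\subset\mathcal G_0(B_{X^{**}})$; that is, regarding $X$ as a subspace of $X^{**}$ canonically, the map $\rho:\mathcal G_0(B_X)\to\mathcal G_0(B_{X^{**}})$, $\rho(\varphi)(f)=\varphi(f|_{B_X})$ for $f\in\mathcal HL_0(B_{X^{**}})$, is a linear isometry onto its image.
   Context: $X$ is symmetrically regular if every bounded symmetric linear operator $T:X\to X^*$ (i.e. $T(x)(y)=T(y)(x)$ for all $x,y\in X$) is weakly compact. $B_X$ is the open unit ball of $X$. $\mathcal HL_0(B_X)$ is the Banach space of holomorphic Lipschitz functions $f:B_X\to\mathbb C$ with $f(0)=0$, normed by the Lipschitz constant $L(f)$. With $\tau_0$ the compact-open topology (uniform convergence on compact subsets of $B_X$), $\mathcal G_0(B_X)=\{\varphi\in\mathcal HL_0(B_X)^*: \varphi \text{ restricted to } \{f:L(f)\le1\}\text{ is }\tau_0\text{-continuous}\}$, with the norm of $\mathcal HL_0(B_X)^*$; similarly for $X^{**}$. *)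

theory Defs
  imports "HOL-Analysis.Analysis"
begin

section \<open>Complex normed spaces and bounded complex-linear maps\<close>

class complex_normed_vector = real_normed_vector +
  fixes scaleC :: "complex \<Rightarrow> 'a \<Rightarrow> 'a"  (infixr "*\<^sub>C" 75)
  assumes scaleC_add_right: "c *\<^sub>C (x + y) = c *\<^sub>C x + c *\<^sub>C y"
    and scaleC_add_left: "(c + d) *\<^sub>C x = c *\<^sub>C x + d *\<^sub>C x"
    and scaleC_scaleC: "c *\<^sub>C (d *\<^sub>C x) = (c * d) *\<^sub>C x"
    and scaleC_of_real: "complex_of_real r *\<^sub>C x = r *\<^sub>R x"
    and norm_scaleC: "norm (c *\<^sub>C x) = norm c * norm x"

class complex_banach = complex_normed_vector + banach

instantiation complex :: complex_normed_vector
begin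

definition scaleC_complex :: "complex \<Rightarrow> complex \<Rightarrow> complex"
  where "scaleC_complex c x = c * x"

instance
  by standard
    (simp_all add: scaleC_complex_def algebra_simps norm_mult scaleR_conv_of_real)

end

definition bounded_clinear :: "('a::complex_normed_vector \<Rightarrow> 'b::complex_normed_vector) \<Rightarrow> bool"
  where "bounded_clinear f \<longleftrightarrow>
    bounded_linear f \<and> (\<forall>c x. f (c *\<^sub>C x) = c *\<^sub>C f x)"

lemma bounded_clinear_imp_bounded_linear: "bounded_clinear f \<Longrightarrow> bounded_linear f"
  by (simp add: bounded_clinear_def)

lemma bounded_clinear_scaleC: "bounded_clinear f \<Longrightarrow> f (c *\<^sub>C x) = c *\<^sub>C f x"
  by (simp add: bounded_clinear_def)

lemma bounded_clinearI:
  assumes "\<And>x y. f (x + y) = f x + f y"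
    and "\<And>c x. f (c *\<^sub>C x) = c *\<^sub>C f x"
    and "\<And>x. norm (f x) \<le> K * norm x"
  shows "bounded_clinear f"
  unfolding bounded_clinear_def
proof
  have "f (r *\<^sub>R x) = r *\<^sub>R f x" for r x
    using assms(2)[of "complex_of_real r" x] by (simp add: scaleC_of_real)
  then show "bounded_linear f"
    using assms(1,3) by (intro bounded_linear_intro[where K = K]) (auto simp: mult.commute)
qed (simp add: assms(2))

lemma bounded_clinear_compose:
  assumes "bounded_clinear f" "bounded_clinear g"
  shows "bounded_clinear (\<lambda>x. f (g x))"
  using assms bounded_linear_compose unfolding bounded_clinear_def by auto


section \<open>The dual space\<close>

typedef (overloaded) 'a cdual = "{f :: 'a::complex_normed_vector \<Rightarrow> complex. bounded_clinear f}"
  morphisms cdual_apply Abs_cdual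
  by (rule exI[of _ "\<lambda>_. 0"]) (auto intro!: bounded_clinearI[where K = 0] simp: scaleC_complex_def)

setup_lifting type_definition_cdual

instantiation cdual :: (complex_normed_vector) complex_normed_vector
begin

lift_definition norm_cdual :: "'a cdual \<Rightarrow> real" is onorm .

lift_definition zero_cdual :: "'a cdual" is "\<lambda>_. 0"
  by (auto intro!: bounded_clinearI[where K = 0] simp: scaleC_complex_def)

lift_definition plus_cdual :: "'a cdual \<Rightarrow> 'a cdual \<Rightarrow> 'a cdual" is "\<lambda>f g x. f x + g x"
  by (auto simp: bounded_clinear_def scaleC_add_right intro: bounded_linear_add)

lift_definition minus_cdual :: "'a cdual \<Rightarrow> 'a cdual \<Rightarrow> 'a cdual" is "\<lambda>f g x. f x - g x"
  by (auto simp: bounded_clinear_def scaleC_complex_def algebra_simps intro: bounded_linear_sub)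

lift_definition uminus_cdual :: "'a cdual \<Rightarrow> 'a cdual" is "\<lambda>f x. - f x"
  by (auto simp: bounded_clinear_def scaleC_complex_def intro: bounded_linear_minus)

lift_definition scaleC_cdual :: "complex \<Rightarrow> 'a cdual \<Rightarrow> 'a cdual" is "\<lambda>c f x. c * f x"
  by (auto simp: bounded_clinear_def scaleC_complex_def intro: bounded_linear_const_mult)

definition scaleR_cdual :: "real \<Rightarrow> 'a cdual \<Rightarrow> 'a cdual"
  where "scaleR_cdual r f = complex_of_real r *\<^sub>C f"

definition dist_cdual :: "'a cdual \<Rightarrow> 'a cdual \<Rightarrow> real"
  where "dist_cdual f g = norm (f - g)"

definition uniformity_cdual :: "('a cdual \<times> 'a cdual) filter"
  where "uniformity_cdual = (INF e\<in>{0 <..}. principal {(f, g). dist f g < e})"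

definition open_cdual :: "'a cdual set \<Rightarrow> bool"
  where "open_cdual S = (\<forall>f\<in>S. \<forall>\<^sub>F (f', g) in uniformity. f' = f \<longrightarrow> g \<in> S)"

definition sgn_cdual :: "'a cdual \<Rightarrow> 'a cdual"
  where "sgn_cdual f = inverse (norm f) *\<^sub>R f"

instance
proof
  fix f g h :: "'a cdual" and c d :: complex and r s :: real
  show "dist f g = norm (f - g)" by (simp add: dist_cdual_def)
  show "f + g + h = f + (g + h)" by transfer (simp add: algebra_simps)
  show "f + g = g + f" by transfer (simp add: algebra_simps)
  show "0 + f = f" by transfer simp
  show "- f + f = 0" by transfer simp
  show "f - g = f + - g" by transfer simp
  show "r *\<^sub>R (f + g) = r *\<^sub>R f + r *\<^sub>R g"
    unfolding scaleR_cdual_def by transfer (simp add: algebra_simps)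
  show "(r + s) *\<^sub>R f = r *\<^sub>R f + s *\<^sub>R f"
    unfolding scaleR_cdual_def by transfer (simp add: algebra_simps)
  show "r *\<^sub>R s *\<^sub>R f = (r * s) *\<^sub>R f"
    unfolding scaleR_cdual_def by transfer (simp add: algebra_simps)
  show "1 *\<^sub>R f = f" unfolding scaleR_cdual_def by transfer simp
  show "sgn f = inverse (norm f) *\<^sub>R f" by (simp add: sgn_cdual_def)
  show "uniformity = (INF e\<in>{0 <..}. principal {(f :: 'a cdual, g). dist f g < e})"
    by (simp add: uniformity_cdual_def)
  show "open S = (\<forall>f\<in>S. \<forall>\<^sub>F (f', g) in uniformity. f' = f \<longrightarrow> g \<in> S)" for S :: "'a cdual set"
    by (simp add: open_cdual_def)
  show "norm f = 0 \<longleftrightarrow> f = 0"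
    by transfer (auto simp: onorm_eq_0 bounded_clinear_def)
  show "norm (f + g) \<le> norm f + norm g"
    by transfer (auto intro: onorm_triangle simp: bounded_clinear_def)
  have nC: "norm (c *\<^sub>C f) = norm c * norm f" for c and f :: "'a cdual"
  proof -
    have le: "norm (c *\<^sub>C f) \<le> norm c * norm f" for c and f :: "'a cdual"
    proof transfer
      fix c and f :: "'a \<Rightarrow> complex"
      assume "bounded_clinear f"
      then have "bounded_linear f" by (simp add: bounded_clinear_def)
      then show "onorm (\<lambda>x. c * f x) \<le> norm c * onorm f"
        by (intro onorm_bound)
          (auto simp: norm_mult mult.assoc intro!: mult_left_mono onorm mult_nonneg_nonneg onorm_pos_le)
    qed
    show ?thesis
    proof (cases "c = 0")
      case True
      have "norm ((0::complex) *\<^sub>C f) = 0" by transfer (simp add: onorm_zero)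
      then show ?thesis using True by simp
    next
      case False
      have "f = inverse c *\<^sub>C (c *\<^sub>C f)"
        using False by transfer (simp add: field_simps)
      then have "norm f \<le> norm (inverse c) * norm (c *\<^sub>C f)"
        using le[of "inverse c" "c *\<^sub>C f"] by simp
      then have "norm c * norm f \<le> norm c * (inverse (norm c) * norm (c *\<^sub>C f))"
        by (intro mult_left_mono) (simp_all add: norm_inverse)
      then have "norm c * norm f \<le> norm (c *\<^sub>C f)"
        using False by (simp flip: mult.assoc)
      then show ?thesis using le[of c f] by simp
    qed
  qed
  show "norm (c *\<^sub>C f) = norm c * norm f" by (rule nC)
  show "norm (r *\<^sub>R f) = \<bar>r\<bar> * norm f" unfolding scaleR_cdual_def nC by simp
  show "c *\<^sub>C (f + g) = c *\<^sub>C f + c *\<^sub>C g" by transfer (simp add: algebra_simps)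
  show "(c + d) *\<^sub>C f = c *\<^sub>C f + d *\<^sub>C f" by transfer (simp add: algebra_simps)
  show "c *\<^sub>C (d *\<^sub>C f) = (c * d) *\<^sub>C f" by transfer (simp add: algebra_simps)
  show "complex_of_real r *\<^sub>C f = r *\<^sub>R f" by (simp add: scaleR_cdual_def)
qed

end

lemma cdual_apply_add: "cdual_apply (f + g) x = cdual_apply f x + cdual_apply g x"
  by transfer simp

lemma cdual_apply_scaleC: "cdual_apply (c *\<^sub>C f) x = c * cdual_apply f x"
  by transfer simp

lemma bounded_clinear_cdual_apply: "bounded_clinear (cdual_apply f)"
  using cdual_apply[of f] by simp

lemma norm_cdual_apply_le: "norm (cdual_apply f x) \<le> norm f * norm x"
  by transfer (auto intro: onorm simp: bounded_clinear_def)

lift_definition bidual_embed :: "'a::complex_normed_vector \<Rightarrow> 'a cdual cdual"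
  is "\<lambda>x f. cdual_apply f x"
proof -
  fix x :: 'a
  show "bounded_clinear (\<lambda>f. cdual_apply f x)"
    using norm_cdual_apply_le[of _ x]
    by (intro bounded_clinearI[where K = "norm x"])
      (simp_all add: cdual_apply_add cdual_apply_scaleC scaleC_complex_def mult.commute)
qed

lemma norm_bidual_embed_le: "norm (bidual_embed x) \<le> norm x"
proof transfer
  fix x :: 'a
  show "onorm (\<lambda>f. cdual_apply f x) \<le> norm x"
    using norm_cdual_apply_le[of _ x] by (intro onorm_bound) (simp_all add: mult.commute)
qed

lemma bounded_clinear_bidual_embed: "bounded_clinear bidual_embed"
proof (rule bounded_clinearI[where K = 1])
  fix x y :: 'a and c
  show "bidual_embed (x + y) = bidual_embed x + bidual_embed y"
    by transfer (simp add: linear_add bounded_linear.linear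
        bounded_clinear_imp_bounded_linear[OF bounded_clinear_cdual_apply])
  show "bidual_embed (c *\<^sub>C x) = c *\<^sub>C bidual_embed x"
    by transfer
      (simp add: bounded_clinear_scaleC[OF bounded_clinear_cdual_apply] scaleC_complex_def)
  show "norm (bidual_embed x) \<le> 1 * norm x"
    by (simp add: norm_bidual_embed_le)
qed


section \<open>Symmetric regularity\<close>

definition weak_topology :: "'a::complex_normed_vector topology"
  where "weak_topology = pullback_topology UNIV (\<lambda>x f. cdual_apply f x) euclidean"
    \<comment> \<open>\<open>euclidean\<close> is here the product topology on \<open>'a cdual \<Rightarrow> complex\<close>, so this is the
      coarsest topology making all elements of the dual continuous.\<close>

definition weakly_compact_operator ::
    "('a::complex_normed_vector \<Rightarrow> 'b::complex_normed_vector) \<Rightarrow> bool"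
  where "weakly_compact_operator T \<longleftrightarrow> bounded_clinear T \<and>
    compactin weak_topology (weak_topology closure_of (T ` ball 0 1))"

definition symmetrically_regular :: "'a::complex_banach itself \<Rightarrow> bool"
  where "symmetrically_regular _ \<longleftrightarrow>
    (\<forall>T :: 'a \<Rightarrow> 'a cdual.
      bounded_clinear T \<and> (\<forall>x y. cdual_apply (T x) y = cdual_apply (T y) x)
        \<longrightarrow> weakly_compact_operator T)"


section \<open>Holomorphic Lipschitz functions on the open unit ball\<close>

definition cholomorphic_on ::
    "('a::complex_normed_vector \<Rightarrow> 'b::complex_normed_vector) \<Rightarrow> 'a set \<Rightarrow> bool"
  where "cholomorphic_on f U \<longleftrightarrow>
    open U \<and> (\<forall>x\<in>U. \<exists>D. bounded_clinear D \<and> (f has_derivative D) (at x))"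

text \<open>A function on the open unit ball is represented by its extension by zero to the whole
  space, so that equality in \<open>hl0\<close> is equality on the ball.\<close>

typedef (overloaded) 'a hl0 =
  "{f :: 'a::complex_normed_vector \<Rightarrow> complex.
      cholomorphic_on f (ball 0 1) \<and> (\<exists>C. C-lipschitz_on (ball 0 1) f) \<and> f 0 = 0 \<and>
      (\<forall>x. x \<notin> ball 0 1 \<longrightarrow> f x = 0)}"
  morphisms hl0_apply Abs_hl0
proof (rule exI[of _ "\<lambda>_. 0"], simp, intro conjI)
  show "cholomorphic_on (\<lambda>_::'a. 0::complex) (ball 0 1)"
    by (auto simp: cholomorphic_on_def scaleC_complex_def
        intro!: exI[of _ "\<lambda>_. 0"] bounded_clinearI[where K = 0])
  show "\<exists>C. C-lipschitz_on (ball 0 1) (\<lambda>_::'a. 0::complex)"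
    by (rule exI[of _ 0]) (simp add: lipschitz_on_def)
qed

setup_lifting type_definition_hl0

text \<open>Pairs with \<open>x = y\<close> contribute \<open>0 / 0 = 0\<close> to the supremum, which is therefore that over
  \<open>x \<noteq> y\<close>, and is \<open>0\<close> for the zero space.\<close>

definition lip_const :: "('a::complex_normed_vector \<Rightarrow> complex) \<Rightarrow> real"
  where "lip_const f =
    (SUP (x, y) \<in> ball 0 1 \<times> ball 0 1. norm (f x - f y) / norm (x - y))"

lemma lip_const_least:
  fixes f :: "'a::complex_normed_vector \<Rightarrow> complex"
  assumes "0 \<le> C" "\<And>x y. x \<in> ball 0 1 \<Longrightarrow> y \<in> ball 0 1 \<Longrightarrow> norm (f x - f y) \<le> C * norm (x - y)"
  shows "lip_const f \<le> C"
  unfolding lip_const_def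
proof (rule cSUP_least)
  show "ball (0::'a) 1 \<times> ball (0::'a) 1 \<noteq> {}" by auto
  fix p :: "'a \<times> 'a"
  assume p: "p \<in> ball 0 1 \<times> ball 0 1"
  obtain x y where [simp]: "p = (x, y)" by (cases p)
  show "(case p of (x, y) \<Rightarrow> norm (f x - f y) / norm (x - y)) \<le> C"
    using p assms(1) assms(2)[of x y] by (cases "x = y") (auto simp: divide_le_eq)
qed

lemma lip_const_bdd:
  fixes f :: "'a::complex_normed_vector \<Rightarrow> complex"
  assumes "C-lipschitz_on (ball 0 1) f"
  shows "bdd_above ((\<lambda>(x, y). norm (f x - f y) / norm (x - y)) ` (ball 0 1 \<times> ball 0 1))"
proof (rule bdd_aboveI[of _ C], safe)
  fix x y :: 'a assume "x \<in> ball 0 1" "y \<in> ball 0 1"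
  then show "norm (f x - f y) / norm (x - y) \<le> C"
    using assms lipschitz_onD[OF assms, of x y] lipschitz_on_nonneg[OF assms]
    by (cases "x = y") (auto simp: divide_le_eq dist_norm)
qed

lemma lip_const_nonneg:
  fixes f :: "'a::complex_normed_vector \<Rightarrow> complex"
  assumes "C-lipschitz_on (ball 0 1) f"
  shows "0 \<le> lip_const f"
  unfolding lip_const_def
  by (intro cSUP_upper2[where x = "(0, 0)"] lip_const_bdd[OF assms]) auto

lemma lip_const_upper:
  fixes f :: "'a::complex_normed_vector \<Rightarrow> complex"
  assumes "C-lipschitz_on (ball 0 1) f" "x \<in> ball 0 1" "y \<in> ball 0 1"
  shows "norm (f x - f y) \<le> lip_const f * norm (x - y)"
proof (cases "x = y")
  case False
  have "norm (f x - f y) / norm (x - y) \<le> lip_const f"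
    unfolding lip_const_def
    using assms by (intro cSUP_upper2[where x = "(x, y)"] lip_const_bdd) auto
  then show ?thesis using False by (simp add: divide_le_eq)
qed simp

lemma cholomorphic_on_add:
  fixes f g :: "'a::complex_normed_vector \<Rightarrow> complex"
  assumes "cholomorphic_on f U" "cholomorphic_on g U"
  shows "cholomorphic_on (\<lambda>x. f x + g x) U"
  unfolding cholomorphic_on_def
proof (intro conjI ballI)
  show "open U" using assms by (simp add: cholomorphic_on_def)
  fix x assume "x \<in> U"
  then obtain D E where "bounded_clinear D" "(f has_derivative D) (at x)"
      "bounded_clinear E" "(g has_derivative E) (at x)"
    using assms unfolding cholomorphic_on_def by metis
  then show "\<exists>D. bounded_clinear D \<and> ((\<lambda>x. f x + g x) has_derivative D) (at x)"
    by (intro exI[of _ "\<lambda>h. D h + E h"])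
      (auto intro!: derivative_intros bounded_linear_add
        simp: bounded_clinear_def scaleC_complex_def algebra_simps)
qed

lemma cholomorphic_on_scaleC:
  fixes f :: "'a::complex_normed_vector \<Rightarrow> complex"
  assumes "cholomorphic_on f U"
  shows "cholomorphic_on (\<lambda>x. c * f x) U"
  unfolding cholomorphic_on_def
proof (intro conjI ballI)
  show "open U" using assms by (simp add: cholomorphic_on_def)
  fix x assume "x \<in> U"
  then obtain D where "bounded_clinear D" "(f has_derivative D) (at x)"
    using assms unfolding cholomorphic_on_def by metis
  then show "\<exists>D. bounded_clinear D \<and> ((\<lambda>x. c * f x) has_derivative D) (at x)"
    by (intro exI[of _ "\<lambda>h. c * D h"])
      (auto intro!: derivative_intros bounded_linear_const_mult
        simp: bounded_clinear_def scaleC_complex_def algebra_simps)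
qed

lemma lipschitz_on_add_complex:
  fixes f g :: "'a::metric_space \<Rightarrow> complex"
  assumes "\<exists>C. C-lipschitz_on S f" "\<exists>C. C-lipschitz_on S g"
  shows "\<exists>C. C-lipschitz_on S (\<lambda>x. f x + g x)"
  using assms lipschitz_on_add by blast

lemma lipschitz_on_mult_complex:
  fixes f :: "'a::metric_space \<Rightarrow> complex"
  assumes "\<exists>C. C-lipschitz_on S f"
  shows "\<exists>C. C-lipschitz_on S (\<lambda>x. c * f x)"
proof -
  obtain C where C: "C-lipschitz_on S f" using assms by blast
  have "(norm c * C)-lipschitz_on S (\<lambda>x. c * f x)"
  proof (rule lipschitz_onI)
    fix x y assume "x \<in> S" "y \<in> S"
    then have "dist (f x) (f y) \<le> C * dist x y" using C by (rule lipschitz_onD[rotated])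
    then have "norm c * norm (f x - f y) \<le> norm c * (C * dist x y)"
      by (intro mult_left_mono) (auto simp: dist_norm)
    then show "dist (c * f x) (c * f y) \<le> norm c * C * dist x y"
      by (simp add: dist_norm norm_mult flip: right_diff_distrib)
  qed (use lipschitz_on_nonneg[OF C] in auto)
  then show ?thesis by blast
qed

instantiation hl0 :: (complex_normed_vector) complex_normed_vector
begin

lift_definition norm_hl0 :: "'a hl0 \<Rightarrow> real" is lip_const .

lift_definition scaleC_hl0 :: "complex \<Rightarrow> 'a hl0 \<Rightarrow> 'a hl0" is "\<lambda>c f x. c * f x"
  by (auto intro: cholomorphic_on_scaleC intro!: lipschitz_on_mult_complex)

lift_definition plus_hl0 :: "'a hl0 \<Rightarrow> 'a hl0 \<Rightarrow> 'a hl0" is "\<lambda>f g x. f x + g x"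
  by (auto intro: cholomorphic_on_add intro!: lipschitz_on_add_complex)

lift_definition zero_hl0 :: "'a hl0" is "\<lambda>_. 0"
  by (auto simp: cholomorphic_on_def scaleC_complex_def lipschitz_on_def
      intro!: exI[of _ "\<lambda>_. 0"] exI[of _ "0::real"] bounded_clinearI[where K = 0])

definition uminus_hl0 :: "'a hl0 \<Rightarrow> 'a hl0"
  where "uminus_hl0 f = (- 1) *\<^sub>C f"

definition minus_hl0 :: "'a hl0 \<Rightarrow> 'a hl0 \<Rightarrow> 'a hl0"
  where "minus_hl0 f g = f + - g"

definition scaleR_hl0 :: "real \<Rightarrow> 'a hl0 \<Rightarrow> 'a hl0"
  where "scaleR_hl0 r f = complex_of_real r *\<^sub>C f"

definition dist_hl0 :: "'a hl0 \<Rightarrow> 'a hl0 \<Rightarrow> real"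
  where "dist_hl0 f g = norm (f - g)"

definition uniformity_hl0 :: "('a hl0 \<times> 'a hl0) filter"
  where "uniformity_hl0 = (INF e\<in>{0 <..}. principal {(f, g). dist f g < e})"

definition open_hl0 :: "'a hl0 set \<Rightarrow> bool"
  where "open_hl0 S = (\<forall>f\<in>S. \<forall>\<^sub>F (f', g) in uniformity. f' = f \<longrightarrow> g \<in> S)"

definition sgn_hl0 :: "'a hl0 \<Rightarrow> 'a hl0"
  where "sgn_hl0 f = inverse (norm f) *\<^sub>R f"

instance
proof
  fix f g h :: "'a hl0" and c d :: complex and r s :: real
  show "dist f g = norm (f - g)" by (simp add: dist_hl0_def)
  show "f + g + h = f + (g + h)" by transfer (simp add: algebra_simps)
  show "f + g = g + f" by transfer (simp add: algebra_simps)
  show "0 + f = f" by transfer simp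
  show "- f + f = 0" unfolding uminus_hl0_def by transfer simp
  show "f - g = f + - g" by (simp add: minus_hl0_def)
  show "r *\<^sub>R (f + g) = r *\<^sub>R f + r *\<^sub>R g"
    unfolding scaleR_hl0_def by transfer (simp add: algebra_simps)
  show "(r + s) *\<^sub>R f = r *\<^sub>R f + s *\<^sub>R f"
    unfolding scaleR_hl0_def by transfer (simp add: algebra_simps)
  show "r *\<^sub>R s *\<^sub>R f = (r * s) *\<^sub>R f"
    unfolding scaleR_hl0_def by transfer (simp add: algebra_simps)
  show "1 *\<^sub>R f = f" unfolding scaleR_hl0_def by transfer simp
  show "sgn f = inverse (norm f) *\<^sub>R f" by (simp add: sgn_hl0_def)
  show "uniformity = (INF e\<in>{0 <..}. principal {(f :: 'a hl0, g). dist f g < e})"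
    by (simp add: uniformity_hl0_def)
  show "open S = (\<forall>f\<in>S. \<forall>\<^sub>F (f', g) in uniformity. f' = f \<longrightarrow> g \<in> S)" for S :: "'a hl0 set"
    by (simp add: open_hl0_def)
  show "norm f = 0 \<longleftrightarrow> f = 0"
  proof transfer
    fix f :: "'a \<Rightarrow> complex"
    assume "cholomorphic_on f (ball 0 1) \<and> (\<exists>C. C-lipschitz_on (ball 0 1) f) \<and> f 0 = 0 \<and>
      (\<forall>x. x \<notin> ball 0 1 \<longrightarrow> f x = 0)"
    then obtain C where C: "C-lipschitz_on (ball 0 1) f"
      and f0: "f 0 = 0" and out: "\<And>x. x \<notin> ball 0 1 \<Longrightarrow> f x = 0" by blast
    show "lip_const f = 0 \<longleftrightarrow> f = (\<lambda>_. 0)"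
    proof
      assume "lip_const f = 0"
      show "f = (\<lambda>_. 0)"
      proof
        fix x show "f x = 0"
        proof (cases "x \<in> ball 0 1")
          case True
          then show ?thesis
            using lip_const_upper[OF C True, of 0] \<open>lip_const f = 0\<close> f0 by simp
        qed (rule out)
      qed
    next
      assume "f = (\<lambda>_. 0)"
      then show "lip_const f = 0"
        using lip_const_nonneg[OF C] lip_const_least[of 0 f] by auto
    qed
  qed
  show "norm (f + g) \<le> norm f + norm g"
  proof transfer
    fix f g :: "'a \<Rightarrow> complex"
    assume "cholomorphic_on f (ball 0 1) \<and> (\<exists>C. C-lipschitz_on (ball 0 1) f) \<and> f 0 = 0 \<and>
        (\<forall>x. x \<notin> ball 0 1 \<longrightarrow> f x = 0)"
      and "cholomorphic_on g (ball 0 1) \<and> (\<exists>C. C-lipschitz_on (ball 0 1) g) \<and> g 0 = 0 \<and>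
        (\<forall>x. x \<notin> ball 0 1 \<longrightarrow> g x = 0)"
    then obtain C D where C: "C-lipschitz_on (ball 0 1) f" and D: "D-lipschitz_on (ball 0 1) g"
      by blast
    show "lip_const (\<lambda>x. f x + g x) \<le> lip_const f + lip_const g"
    proof (rule lip_const_least)
      show "0 \<le> lip_const f + lip_const g"
        using lip_const_nonneg[OF C] lip_const_nonneg[OF D] by simp
      fix x y :: 'a assume xy: "x \<in> ball 0 1" "y \<in> ball 0 1"
      have "norm (f x + g x - (f y + g y)) \<le> norm (f x - f y) + norm (g x - g y)"
        by (metis add_diff_add norm_triangle_ineq)
      also have "\<dots> \<le> lip_const f * norm (x - y) + lip_const g * norm (x - y)"
        by (intro add_mono lip_const_upper[OF C xy] lip_const_upper[OF D xy])
      finally show "norm (f x + g x - (f y + g y)) \<le> (lip_const f + lip_const g) * norm (x - y)"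
        by (simp add: distrib_right)
    qed
  qed
  have nC: "norm (c *\<^sub>C f) = norm c * norm f" for c and f :: "'a hl0"
  proof -
    have le: "norm (c *\<^sub>C f) \<le> norm c * norm f" for c and f :: "'a hl0"
    proof transfer
      fix c and f :: "'a \<Rightarrow> complex"
      assume "cholomorphic_on f (ball 0 1) \<and> (\<exists>C. C-lipschitz_on (ball 0 1) f) \<and> f 0 = 0 \<and>
        (\<forall>x. x \<notin> ball 0 1 \<longrightarrow> f x = 0)"
      then obtain C where C: "C-lipschitz_on (ball 0 1) f" by blast
      show "lip_const (\<lambda>x. c * f x) \<le> norm c * lip_const f"
        by (rule lip_const_least)
          (auto simp: lip_const_nonneg[OF C] norm_mult mult.assoc simp flip: right_diff_distrib
            intro!: mult_left_mono lip_const_upper[OF C])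
    qed
    show ?thesis
    proof (cases "c = 0")
      case True
      have "0 \<le> norm (0 *\<^sub>C f)"
        by transfer (auto intro!: lip_const_nonneg[where C = 0] simp: lipschitz_on_def)
      then show ?thesis using True le[of 0 f] by simp
    next
      case False
      have "f = inverse c *\<^sub>C (c *\<^sub>C f)"
        using False by transfer (simp add: field_simps)
      then have "norm f \<le> norm (inverse c) * norm (c *\<^sub>C f)"
        using le[of "inverse c" "c *\<^sub>C f"] by simp
      then have "norm c * norm f \<le> norm c * (inverse (norm c) * norm (c *\<^sub>C f))"
        by (intro mult_left_mono) (simp_all add: norm_inverse)
      then have "norm c * norm f \<le> norm (c *\<^sub>C f)"
        using False by (simp flip: mult.assoc)
      then show ?thesis using le[of c f] by simp
    qed
  qed
  show "norm (c *\<^sub>C f) = norm c * norm f" by (rule nC)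
  show "norm (r *\<^sub>R f) = \<bar>r\<bar> * norm f" unfolding scaleR_hl0_def nC by simp
  show "c *\<^sub>C (f + g) = c *\<^sub>C f + c *\<^sub>C g" by transfer (simp add: algebra_simps)
  show "(c + d) *\<^sub>C f = c *\<^sub>C f + d *\<^sub>C f" by transfer (simp add: algebra_simps)
  show "c *\<^sub>C (d *\<^sub>C f) = (c * d) *\<^sub>C f" by transfer (simp add: algebra_simps)
  show "complex_of_real r *\<^sub>C f = r *\<^sub>R f" by (simp add: scaleR_hl0_def)
qed

end


section \<open>The predual \<open>G0\<close>\<close>

definition compact_open :: "'a::complex_normed_vector hl0 topology"
  where "compact_open = topology (\<lambda>W. \<forall>f\<in>W. \<exists>K e. compact K \<and> K \<subseteq> ball 0 1 \<and> e > 0 \<and>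
    {g. \<forall>x\<in>K. norm (hl0_apply g x - hl0_apply f x) < e} \<subseteq> W)"

lemma openin_compact_open:
  "openin compact_open W \<longleftrightarrow> (\<forall>f\<in>W. \<exists>K e. compact K \<and> K \<subseteq> ball 0 1 \<and> e > 0 \<and>
    {g. \<forall>x\<in>K. norm (hl0_apply g x - hl0_apply f x) < e} \<subseteq> W)"
proof -
  define B where "B f K e = {g :: 'a hl0. \<forall>x\<in>K. norm (hl0_apply g x - hl0_apply f x) < e}"
    for f K and e :: real
  define P where "P W \<longleftrightarrow> (\<forall>f\<in>W. \<exists>K e. compact K \<and> K \<subseteq> ball 0 1 \<and> e > 0 \<and> B f K e \<subseteq> W)" for W
  have "istopology P"
    unfolding istopology_def
  proof (intro conjI allI impI)
    fix S T assume S: "P S" and T: "P T"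
    show "P (S \<inter> T)"
      unfolding P_def
    proof
      fix f assume "f \<in> S \<inter> T"
      then obtain K d L e where "compact K" "K \<subseteq> ball 0 1" "d > 0" "B f K d \<subseteq> S"
        "compact L" "L \<subseteq> ball 0 1" "e > 0" "B f L e \<subseteq> T"
        using S T unfolding P_def by (metis IntD1 IntD2)
      moreover have "B f (K \<union> L) (min d e) \<subseteq> B f K d \<inter> B f L e"
        by (auto simp: B_def)
      ultimately show "\<exists>K e. compact K \<and> K \<subseteq> ball 0 1 \<and> e > 0 \<and> B f K e \<subseteq> S \<inter> T"
        by (intro exI[of _ "K \<union> L"] exI[of _ "min d e"]) (auto intro: compact_Un)
    qed
  next
    fix \<W> assume "\<forall>W\<in>\<W>. P W"
    then show "P (\<Union>\<W>)"
      unfolding P_def by (meson UnionE Union_upper subset_trans)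
  qed
  then show ?thesis
    unfolding compact_open_def P_def B_def by (simp add: topology_inverse')
qed

definition G0 :: "'a::complex_normed_vector hl0 cdual set"
  where "G0 = {\<phi>. continuous_map (subtopology compact_open {f. norm f \<le> 1}) euclidean
    (cdual_apply \<phi>)}"

lemma G0_add: "\<phi> \<in> G0 \<Longrightarrow> \<psi> \<in> G0 \<Longrightarrow> \<phi> + \<psi> \<in> G0"
  using continuous_map_add[of _ "cdual_apply \<phi>" "cdual_apply \<psi>"]
  by (simp add: G0_def flip: cdual_apply_add)

lemma G0_scaleC: "\<phi> \<in> G0 \<Longrightarrow> c *\<^sub>C \<phi> \<in> G0"
  using continuous_map_compose[of _ euclidean "cdual_apply \<phi>" euclidean "\<lambda>z. c * z"]
  by (simp add: G0_def o_def continuous_on_mult_left flip: cdual_apply_scaleC)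


section \<open>The map \<open>\<rho>\<close>\<close>

lemma bidual_embed_in_ball: "x \<in> ball 0 1 \<Longrightarrow> bidual_embed x \<in> ball 0 1"
  using norm_bidual_embed_le[of x] by simp

lift_definition hl0_restrict :: "'a::complex_normed_vector cdual cdual hl0 \<Rightarrow> 'a hl0"
  is "\<lambda>f x. if x \<in> ball 0 1 then f (bidual_embed x) else 0"
proof -
  fix f :: "'a cdual cdual \<Rightarrow> complex"
  assume "cholomorphic_on f (ball 0 1) \<and> (\<exists>C. C-lipschitz_on (ball 0 1) f) \<and> f 0 = 0 \<and>
      (\<forall>x. x \<notin> ball 0 1 \<longrightarrow> f x = 0)"
  then obtain C where hol: "cholomorphic_on f (ball 0 1)" and C: "C-lipschitz_on (ball 0 1) f"
    and f0: "f 0 = 0" by blast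
  let ?g = "\<lambda>x::'a. if x \<in> ball 0 1 then f (bidual_embed x) else 0"
  have J: "bounded_linear (bidual_embed :: 'a \<Rightarrow> _)"
    by (rule bounded_clinear_imp_bounded_linear[OF bounded_clinear_bidual_embed])
  have "cholomorphic_on ?g (ball 0 1)"
    unfolding cholomorphic_on_def
  proof (intro conjI ballI)
    fix x :: 'a assume x: "x \<in> ball 0 1"
    then obtain D where D: "bounded_clinear D" "(f has_derivative D) (at (bidual_embed x))"
      using hol bidual_embed_in_ball unfolding cholomorphic_on_def by blast
    have "((\<lambda>x. f (bidual_embed x)) has_derivative (\<lambda>h. D (bidual_embed h))) (at x)"
      by (rule has_derivative_compose[OF bounded_linear.has_derivative[OF J has_derivative_ident] D(2)])
    then have "(?g has_derivative (\<lambda>h. D (bidual_embed h))) (at x)"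
      by (rule has_derivative_transform_within_open[of _ _ _ _ "ball 0 1"]) (use x in auto)
    then show "\<exists>D. bounded_clinear D \<and> (?g has_derivative D) (at x)"
      using bounded_clinear_compose[OF D(1) bounded_clinear_bidual_embed] by blast
  qed simp
  moreover have "C-lipschitz_on (ball 0 1) ?g"
  proof (rule lipschitz_onI)
    fix x y :: 'a assume xy: "x \<in> ball 0 1" "y \<in> ball 0 1"
    then have "dist (?g x) (?g y) \<le> C * dist (bidual_embed x) (bidual_embed y)"
      using lipschitz_onD[OF C bidual_embed_in_ball bidual_embed_in_ball] by simp
    also have "\<dots> \<le> C * dist x y"
      using norm_bidual_embed_le[of "x - y"] lipschitz_on_nonneg[OF C]
      by (intro mult_left_mono) (auto simp: dist_norm linear_diff[OF bounded_linear.linear[OF J]])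
    finally show "dist (?g x) (?g y) \<le> C * dist x y" .
  qed (rule lipschitz_on_nonneg[OF C])
  moreover have "?g 0 = 0"
    using f0 linear_0[OF bounded_linear.linear[OF J]] by simp
  ultimately show "cholomorphic_on ?g (ball 0 1) \<and> (\<exists>C. C-lipschitz_on (ball 0 1) ?g) \<and>
      ?g 0 = 0 \<and> (\<forall>x. x \<notin> ball 0 1 \<longrightarrow> ?g x = 0)" by auto
qed

lemma hl0_restrict_add: "hl0_restrict (f + g) = hl0_restrict f + hl0_restrict g"
  by transfer auto

lemma hl0_restrict_scaleC: "hl0_restrict (c *\<^sub>C f) = c *\<^sub>C hl0_restrict f"
  by transfer auto

lemma norm_hl0_restrict_le:
  "norm (hl0_restrict (f :: 'a::complex_normed_vector cdual cdual hl0)) \<le> norm f"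
proof transfer
  fix f :: "'a cdual cdual \<Rightarrow> complex"
  assume "cholomorphic_on f (ball 0 1) \<and> (\<exists>C. C-lipschitz_on (ball 0 1) f) \<and> f 0 = 0 \<and>
      (\<forall>x. x \<notin> ball 0 1 \<longrightarrow> f x = 0)"
  then obtain C where C: "C-lipschitz_on (ball 0 1) f" by blast
  have J: "bounded_linear (bidual_embed :: 'a \<Rightarrow> _)"
    by (rule bounded_clinear_imp_bounded_linear[OF bounded_clinear_bidual_embed])
  show "lip_const (\<lambda>x::'a. if x \<in> ball 0 1 then f (bidual_embed x) else 0) \<le> lip_const f"
  proof (rule lip_const_least[OF lip_const_nonneg[OF C]])
    fix x y :: 'a assume xy: "x \<in> ball 0 1" "y \<in> ball 0 1"
    have "norm (f (bidual_embed x) - f (bidual_embed y))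
        \<le> lip_const f * norm (bidual_embed x - bidual_embed y)"
      using lip_const_upper[OF C bidual_embed_in_ball[OF xy(1)] bidual_embed_in_ball[OF xy(2)]] .
    also have "\<dots> \<le> lip_const f * norm (x - y)"
      using norm_bidual_embed_le[of "x - y"] lip_const_nonneg[OF C]
      by (intro mult_left_mono) (auto simp: linear_diff[OF bounded_linear.linear[OF J]])
    finally show "norm ((if x \<in> ball 0 1 then f (bidual_embed x) else 0) -
        (if y \<in> ball 0 1 then f (bidual_embed y) else 0)) \<le> lip_const f * norm (x - y)"
      using xy by simp
  qed
qed

lemma bounded_clinear_hl0_restrict: "bounded_clinear hl0_restrict"
  by (rule bounded_clinearI[where K = 1])
    (simp_all add: hl0_restrict_add hl0_restrict_scaleC norm_hl0_restrict_le)

lift_definition rho :: "'a::complex_normed_vector hl0 cdual \<Rightarrow> 'a cdual cdual hl0 cdual"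
  is "\<lambda>\<phi> f. \<phi> (hl0_restrict f)"
  by (rule bounded_clinear_compose[OF _ bounded_clinear_hl0_restrict])

lemma cdual_apply_rho: "cdual_apply (rho \<phi>) f = cdual_apply \<phi> (hl0_restrict f)"
  by transfer simp

end

theory Submission
  imports Defs "HOL-Library.Function_Algebras" "HOL-Complex_Analysis.Complex_Analysis"
begin

text \<open>The isometry rests on one fact: every \<open>f\<close> in \<open>HL\<^sub>0(B\<^sub>X)\<close> has an extension \<open>g\<close> in
\<open>HL\<^sub>0(B\<^bsub>X**\<^esub>)\<close> with \<open>L(g) \<le> L(f)\<close> (\<open>hl0_norm_preserving_extension\<close>). Given this,
\<open>\<phi>(f) = rho(\<phi>)(g)\<close> yields \<open>norm \<phi> \<le> norm (rho \<phi>)\<close>; the reverse inequality holds because restriction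
does not increase the Lipschitz constant. That \<open>rho\<close> maps \<open>G0\<close> into \<open>G0\<close> holds because restriction to
\<open>B\<^sub>X\<close> is continuous for the compact-open topologies.

The extension is built in the style of Lindstroem and Ryan from local reflexivity. A linear contraction
\<open>T\<close> from \<open>X\<^sup>*\<^sup>*\<close> to \<open>X\<close> that fixes \<open>X\<close> would give \<open>g = f \<circ> T\<close>. In general there is none, but there is
a filter of maps \<open>T\<close> along which all the defining properties of such a contraction hold in the limit
(\<open>almost_linear_retractions\<close>). For finitely many properties at a time, suitable \<open>T\<close> are found by
solving a finite linear system approximately in \<open>X\<close> (\<open>approximate_local_reflexivity\<close>), which comes
down to the Hahn-Banach theorem. By Tychonoff the filter can be refined so that all bounded complex
functions of \<open>T\<close> converge, and \<open>g z\<close> is the limit of \<open>f (T z)\<close>.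

The limit \<open>g\<close> is holomorphic because the derivatives converge along with the values, and because a
holomorphic function with Lipschitz constant \<open>K\<close> on the ball satisfies the uniform estimate
\<open>norm (f (x + w) - f x - Df(x) w) \<le> 4 K (norm w)\<^sup>2 / (1 - norm x)\<close>
(\<open>lipschitz_first_order_error_ball\<close>, from the Schwarz lemma), which is a pointwise condition and so
passes to the limit.\<close>

section \<open>The Hahn-Banach theorem\<close>

definition sublinear :: "('v::real_vector \<Rightarrow> real) \<Rightarrow> bool"
  where "sublinear p \<longleftrightarrow>
    (\<forall>x y. p (x + y) \<le> p x + p y) \<and> (\<forall>a x. a > 0 \<longrightarrow> p (a *\<^sub>R x) = a * p x)"

lemma sublinear_add: "sublinear p \<Longrightarrow> p (x + y) \<le> p x + p y"
  by (simp add: sublinear_def)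

lemma sublinear_scale: "sublinear p \<Longrightarrow> a > 0 \<Longrightarrow> p (a *\<^sub>R x) = a * p x"
  by (simp add: sublinear_def)

lemma sublinear_zero: "sublinear p \<Longrightarrow> p 0 = 0"
  using sublinear_scale[of p 2 0] by simp

lemma sublinear_neg: "sublinear p \<Longrightarrow> - p (- x) \<le> p x"
  using sublinear_add[of p x "- x"] sublinear_zero[of p] by simp

text \<open>Every sublinear functional constructed below is an infimum of admissible values: of shifted values
of a functional, of the members of a chain, of the costs of approximate solutions. In each case the
relation between points and admissible values is a convex cone, which makes the infimum
sublinear.\<close>

lemma sublinear_Inf_cone:
  fixes R :: "'v::real_vector \<Rightarrow> real \<Rightarrow> bool"
  assumes add: "\<And>u v s t. R u s \<Longrightarrow> R v t \<Longrightarrow> R (u + v) (s + t)"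
    and scale: "\<And>a v t. a > 0 \<Longrightarrow> R v t \<Longrightarrow> R (a *\<^sub>R v) (a * t)"
    and ne: "\<And>v. \<exists>t. R v t"
    and bdd: "\<And>v. bdd_below {t. R v t}"
  shows "sublinear (\<lambda>v. Inf {t. R v t})"
proof -
  let ?p = "\<lambda>v. Inf {t. R v t}"
  have lower: "?p v \<le> t" if "R v t" for v t
    by (rule cInf_lower) (use that bdd in auto)
  have great: "c \<le> ?p v" if "\<And>t. R v t \<Longrightarrow> c \<le> t" for v c
    by (rule cInf_greatest) (use that ne in auto)
  have sub: "?p (u + v) \<le> ?p u + ?p v" for u v
  proof -
    have "?p (u + v) - s \<le> ?p v" if "R u s" for s
    proof (rule great)
      fix t assume "R v t"
      then have "?p (u + v) \<le> s + t" using that add lower by blast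
      then show "?p (u + v) - s \<le> t" by simp
    qed
    then have "?p (u + v) - ?p v \<le> ?p u" by (intro great) (simp add: algebra_simps)
    then show ?thesis by simp
  qed
  have sc: "a * ?p v \<le> ?p (a *\<^sub>R v)" if a: "a > 0" for a v
  proof (rule great)
    fix t assume "R (a *\<^sub>R v) t"
    then have "R v (inverse a * t)" using scale[of "inverse a" "a *\<^sub>R v" t] a by simp
    then have "?p v \<le> inverse a * t" by (rule lower)
    then show "a * ?p v \<le> t" using a by (simp add: field_simps)
  qed
  have "?p (a *\<^sub>R v) = a * ?p v" if a: "a > 0" for a v
    using sc[OF a, of v] sc[of "inverse a" "a *\<^sub>R v"] a by (simp add: field_simps)
  with sub show ?thesis by (simp add: sublinear_def)
qed

text \<open>The functional is \<open>q x = Inf {p (x + t y) - t p y | t \<ge> 0}\<close>. If \<open>p\<close> is minimal then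
\<open>q = p\<close>, and the last conclusion turns into \<open>p x + p y \<le> p (x + y)\<close>, that is, additivity.
Taking \<open>x = - y\<close> gives \<open>q (- y) \<le> - p y\<close>, which forces every linear functional below \<open>q\<close> to
attain the value \<open>p y\<close> at \<open>y\<close>.\<close>

lemma sublinear_lower_along:
  fixes p :: "'v::real_vector \<Rightarrow> real"
  assumes p: "sublinear p"
  obtains q where "sublinear q" "q \<le> p" "\<And>x. q x \<le> p (x + y) - p y"
proof
  \<comment> \<open>The values are closed upwards: for given \<open>x\<close> and \<open>x'\<close>, subadditivity of \<open>p\<close> bounds the
    shifted value at \<open>x + x'\<close> by the sum of the two shifted values instead of reproducing it.\<close>
  define R where "R x s \<longleftrightarrow> (\<exists>t\<ge>0. p (x + t *\<^sub>R y) - t * p y \<le> s)" for x s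
  have scale: "p (t *\<^sub>R x) = t * p x" if "t \<ge> 0" for t x
    using that sublinear_scale[OF p] sublinear_zero[OF p] by (cases "t = 0") auto
  have bdd: "- p (- x) \<le> s" if R: "R x s" for x s
  proof -
    obtain t where t: "t \<ge> 0" "p (x + t *\<^sub>R y) - t * p y \<le> s" using R R_def by auto
    have "p (t *\<^sub>R y) \<le> p (x + t *\<^sub>R y) + p (- x)"
      using sublinear_add[OF p, of "x + t *\<^sub>R y" "- x"] by simp
    then show ?thesis using t scale[of t y] by simp
  qed
  have bb: "bdd_below {s. R x s}" for x
    using bdd by (intro bdd_belowI[of _ "- p (- x)"]) auto
  have lower: "Inf {s. R x s} \<le> s" if "R x s" for x s
    by (rule cInf_lower) (use that bb in auto)
  show "sublinear (\<lambda>x. Inf {s. R x s})"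
  proof (rule sublinear_Inf_cone)
    fix u v s t assume "R u s" "R v t"
    then obtain a b where ab: "a \<ge> 0" "b \<ge> 0" "p (u + a *\<^sub>R y) - a * p y \<le> s"
      "p (v + b *\<^sub>R y) - b * p y \<le> t" by (auto simp: R_def)
    have "p (u + v + (a + b) *\<^sub>R y) \<le> p (u + a *\<^sub>R y) + p (v + b *\<^sub>R y)"
      using sublinear_add[OF p, of "u + a *\<^sub>R y" "v + b *\<^sub>R y"] by (simp add: algebra_simps)
    then show "R (u + v) (s + t)"
      unfolding R_def using ab by (intro exI[of _ "a + b"]) (simp add: algebra_simps)
  next
    fix a v t assume a: "(a::real) > 0" and "R v t"
    then obtain b where b: "b \<ge> 0" "p (v + b *\<^sub>R y) - b * p y \<le> t" by (auto simp: R_def)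
    have "p (a *\<^sub>R v + (a * b) *\<^sub>R y) = a * p (v + b *\<^sub>R y)"
      using sublinear_scale[OF p a, of "v + b *\<^sub>R y"] by (simp add: algebra_simps)
    then show "R (a *\<^sub>R v) (a * t)"
      unfolding R_def using a b(1) mult_left_mono[OF b(2), of a]
      by (intro exI[of _ "a * b"]) (simp add: algebra_simps)
  next
    have "R v (p v)" for v unfolding R_def by (rule exI[of _ 0]) simp
    then show "\<exists>t. R v t" for v by blast
  qed (rule bb)
  show "(\<lambda>x. Inf {s. R x s}) \<le> p"
    by (intro le_funI lower) (auto simp: R_def intro!: exI[of _ "0::real"])
  show "Inf {s. R x s} \<le> p (x + y) - p y" for x
    by (rule lower) (auto simp: R_def intro!: exI[of _ "1::real"])
qed

lemma minimal_sublinear_exists: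
  fixes p :: "'v::real_vector \<Rightarrow> real"
  assumes p: "sublinear p"
  obtains m where "sublinear m" "m \<le> p" "\<And>q. sublinear q \<Longrightarrow> q \<le> m \<Longrightarrow> q = m"
proof -
  define A where "A = {q. sublinear q \<and> q \<le> p}"
  define P where "P = (\<lambda>q r :: 'v \<Rightarrow> real. r \<le> q)"
  have "\<exists>m\<in>A. \<forall>q\<in>A. P m q \<longrightarrow> q = m"
  proof (rule predicate_Zorn)
    show "partial_order_on A (relation_of P A)"
      unfolding P_def by (rule partial_order_on_relation_ofI) auto
    fix C assume C: "C \<in> Chains (relation_of P A)"
    then have CA: "C \<subseteq> A" and tot: "\<And>q r. q \<in> C \<Longrightarrow> r \<in> C \<Longrightarrow> q \<le> r \<or> r \<le> q"
      by (auto simp: Chains_def relation_of_def P_def)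
    show "\<exists>u\<in>A. \<forall>q\<in>C. P q u"
    proof (cases "C = {}")
      case True
      then show ?thesis using p by (auto simp: A_def)
    next
      case False
      define R where "R x s \<longleftrightarrow> (\<exists>q\<in>C. q x \<le> s)" for x s
      have sl: "sublinear q" "q \<le> p" if "q \<in> C" for q using that CA by (auto simp: A_def)
      have bdd: "- p (- x) \<le> s" if R: "R x s" for x s
      proof -
        obtain q where q: "q \<in> C" "q x \<le> s" using R R_def by auto
        have "- p (- x) \<le> - q (- x)" using le_funD[OF sl(2)[OF q(1)]] by simp
        also have "\<dots> \<le> q x" by (rule sublinear_neg[OF sl(1)[OF q(1)]])
        finally show ?thesis using q(2) by simp
      qed
      have bb: "bdd_below {s. R x s}" for x
        using bdd by (intro bdd_belowI[of _ "- p (- x)"]) auto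
      have lower: "Inf {s. R x s} \<le> s" if "R x s" for x s
        by (rule cInf_lower) (use that bb in auto)
      have "sublinear (\<lambda>x. Inf {s. R x s})"
      proof (rule sublinear_Inf_cone)
        fix u v s t assume "R u s" "R v t"
        then obtain q r where qr: "q \<in> C" "r \<in> C" "q u \<le> s" "r v \<le> t" by (auto simp: R_def)
        then obtain w where w: "w \<in> C" "w \<le> q" "w \<le> r" using tot by blast
        have "w (u + v) \<le> w u + w v" by (rule sublinear_add[OF sl(1)[OF w(1)]])
        then have "w (u + v) \<le> s + t"
          using qr le_funD[OF w(2), of u] le_funD[OF w(3), of v] by linarith
        then show "R (u + v) (s + t)" using w(1) by (auto simp: R_def)
      next
        fix a v t assume a: "(a::real) > 0" and "R v t"
        then obtain q where q: "q \<in> C" "q v \<le> t" by (auto simp: R_def)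
        then show "R (a *\<^sub>R v) (a * t)"
          unfolding R_def using sublinear_scale[OF sl(1)[OF q(1)] a] a
          by (auto intro!: bexI[OF _ q(1)])
      next
        show "\<exists>t. R v t" for v using False by (auto simp: R_def)
      qed (rule bb)
      moreover have "(\<lambda>x. Inf {s. R x s}) \<le> q" if "q \<in> C" for q
        by (intro le_funI lower) (use that in \<open>auto simp: R_def\<close>)
      ultimately show ?thesis using False sl(2) unfolding A_def P_def
        by (metis (mono_tags, lifting) equals0I mem_Collect_eq order_trans)
    qed
  qed
  then obtain m where m: "m \<in> A" "\<forall>q\<in>A. q \<le> m \<longrightarrow> q = m" by (auto simp: P_def)
  then show ?thesis by (intro that[of m]) (auto simp: A_def intro: order_trans)
qed

text \<open>Minimal sublinear functionals are linear. Working with functionals defined on the whole space avoids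
the partially defined extensions of the usual argument.\<close>

theorem Hahn_Banach_sublinear:
  fixes p :: "'v::real_vector \<Rightarrow> real"
  assumes p: "sublinear p"
  obtains l where "linear l" "\<And>x. l x \<le> p x" "l b = p b"
proof -
  obtain q where q: "sublinear q" "q \<le> p" "\<And>x. q x \<le> p (x + b) - p b"
    using sublinear_lower_along[OF p] by blast
  obtain m where m: "sublinear m" "m \<le> q" and
    min: "\<And>r. sublinear r \<Longrightarrow> r \<le> m \<Longrightarrow> r = m"
    using minimal_sublinear_exists[OF q(1)] by blast
  \<comment> \<open>Lowering a minimal functional does not change it.\<close>
  have add: "m (x + y) = m x + m y" for x y
  proof -
    obtain r where r: "sublinear r" "r \<le> m" "\<And>x. r x \<le> m (x + y) - m y"
      using sublinear_lower_along[OF m(1)] by blast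
    have "m x \<le> m (x + y) - m y" using r(3)[of x] min[OF r(1,2)] by simp
    then show ?thesis using sublinear_add[OF m(1), of x y] by simp
  qed
  have neg: "m (- x) = - m x" for x
    using add[of x "- x"] sublinear_zero[OF m(1)] by simp
  have scale: "m (a *\<^sub>R x) = a * m x" for a x
  proof (cases "a > 0")
    case False
    then show ?thesis
      using sublinear_scale[OF m(1), of "- a" "x"] neg[of "(- a) *\<^sub>R x"] sublinear_zero[OF m(1)]
      by (cases "a = 0") auto
  qed (rule sublinear_scale[OF m(1)])
  have mp: "m x \<le> p x" for x using m(2) q(2) by (meson le_funD order_trans)
  have "- m b \<le> - p b"
    using le_funD[OF m(2), of "- b"] q(3)[of "- b"] sublinear_zero[OF p] neg[of b] by simp
  then have "m b = p b" using mp[of b] by simp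
  moreover have "linear m" by (rule linearI) (simp_all add: add scale)
  ultimately show ?thesis using mp that by blast
qed

section \<open>Approximate local reflexivity\<close>

lemma linear_cdual_apply: "linear (cdual_apply w)"
  by (rule bounded_linear.linear[OF bounded_clinear_imp_bounded_linear[OF bounded_clinear_cdual_apply]])

lemma cdual_apply_scaleC_right: "cdual_apply w (c *\<^sub>C x) = c * cdual_apply w x"
  using bounded_clinear_scaleC[OF bounded_clinear_cdual_apply] by (simp add: scaleC_complex_def)

lemma cdual_apply_zero: "cdual_apply 0 x = 0"
  by transfer simp

lemma cdual_apply_sum: "cdual_apply (\<Sum>i\<in>F. w i) x = (\<Sum>i\<in>F. cdual_apply (w i) x)"
  by (induction F rule: infinite_finite_induct) (auto simp: cdual_apply_add cdual_apply_zero)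

lemma norm_cdual_le:
  assumes "0 \<le> C" "\<And>u. norm (cdual_apply w u) \<le> C * norm u"
  shows "norm w \<le> C"
  using assms by transfer (auto intro: onorm_bound)

lemma linear_scaleC: "linear (\<lambda>x. c *\<^sub>C x)"
proof (rule linearI)
  show "c *\<^sub>C (r *\<^sub>R x) = r *\<^sub>R (c *\<^sub>C x)" for r and x :: 'a
    by (simp add: scaleC_scaleC mult.commute flip: scaleC_of_real)
qed (rule scaleC_add_right)

lemma scaleC_one: "1 *\<^sub>C x = x" and scaleC_zero_left: "0 *\<^sub>C x = 0"
  using scaleC_of_real[of 1 x] scaleC_of_real[of 0 x] by simp_all

lemma scaleC_diff_left: "(c - d) *\<^sub>C x = c *\<^sub>C x - d *\<^sub>C x"
  using scaleC_add_left[of "c - d" d x] by simp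

lemma scaleC_decompose: "c *\<^sub>C u = Re c *\<^sub>R u + Im c *\<^sub>R (\<i> *\<^sub>C u)"
proof -
  have "c *\<^sub>C u = (complex_of_real (Re c) + \<i> * complex_of_real (Im c)) *\<^sub>C u"
    by (simp flip: complex_eq)
  then show ?thesis
    by (simp add: scaleC_add_left scaleC_of_real linear_cmul[OF linear_scaleC] flip: scaleC_scaleC)
qed

text \<open>A complex-linear functional is determined by its real part \<open>l\<close> through \<open>y u = l u - \<i> l (\<i> u)\<close>.
This carries real Hahn-Banach functionals over to the complex dual.\<close>

lemma cdual_with_real_part:
  fixes l :: "'a::complex_normed_vector \<Rightarrow> real"
  assumes l: "linear l" and bd: "\<And>u. l u \<le> K * norm u"
  obtains y :: "'a cdual" where "\<And>u. Re (cdual_apply y u) = l u"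
proof -
  let ?f = "\<lambda>u. Complex (l u) (- l (\<i> *\<^sub>C u))"
  have abs: "\<bar>l u\<bar> \<le> K * norm u" for u
    using bd[of u] bd[of "- u"] linear_neg[OF l, of u] by simp
  have "bounded_clinear ?f"
  proof (rule bounded_clinearI[where K = "2 * K"])
    show "?f (x + y) = ?f x + ?f y" for x y
      by (simp add: complex_eq_iff linear_add[OF l] scaleC_add_right)
    show "?f (c *\<^sub>C x) = c *\<^sub>C ?f x" for c x
    proof -
      have "l (c *\<^sub>C x) = Re c * l x + Im c * l (\<i> *\<^sub>C x)"
        by (subst scaleC_decompose) (simp add: linear_add[OF l] linear_cmul[OF l])
      moreover have "l (\<i> *\<^sub>C c *\<^sub>C x) = Re c * l (\<i> *\<^sub>C x) - Im c * l x"
        unfolding scaleC_scaleC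
        by (subst scaleC_decompose) (simp add: linear_add[OF l] linear_diff[OF l] linear_cmul[OF l])
      ultimately show ?thesis by (simp add: complex_eq_iff scaleC_complex_def)
    qed
    show "norm (?f x) \<le> 2 * K * norm x" for x
      using cmod_le[of "?f x"] abs[of x] abs[of "\<i> *\<^sub>C x"] by (simp add: norm_scaleC)
  qed
  then show ?thesis
    by (intro that[of "Abs_cdual ?f"]) (simp add: Abs_cdual_inverse)
qed

lemma cdual_norming_vector:
  fixes w :: "'a::complex_normed_vector cdual"
  assumes "w \<noteq> 0" "0 \<le> s" "s < r"
  obtains u where "norm u \<le> r" "s * norm w < Re (cdual_apply w u)"
proof (rule ccontr)
  assume "\<not> thesis"
  then have le: "Re (cdual_apply w u) \<le> s * norm w" if "norm u \<le> r" for u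
    using that \<open>\<And>u. norm u \<le> r \<Longrightarrow> s * norm w < Re (cdual_apply w u) \<Longrightarrow> thesis\<close> by fastforce
  have "norm (cdual_apply w u) \<le> (s * norm w / r) * norm u" for u
  proof (cases "cdual_apply w u = 0")
    case True
    then show ?thesis using assms by simp
  next
    case False
    then have u: "norm u > 0" using linear_0[OF linear_cdual_apply, of w] by auto
    let ?c = "cnj (sgn (cdual_apply w u))"
    let ?v = "?c *\<^sub>C ((r / norm u) *\<^sub>R u)"
    \<comment> \<open>Rotating and rescaling \<open>u\<close> makes the value of \<open>w\<close> real and positive and the norm equal to \<open>r\<close>.\<close>
    have nc: "norm ?c = 1" using False by (simp add: norm_sgn)
    have "norm ?v \<le> r" using u assms by (simp only: norm_scaleC nc) simp
    then have "Re (cdual_apply w ?v) \<le> s * norm w" by (rule le)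
    moreover have "cdual_apply w ?v = of_real (r / norm u) * (?c * cdual_apply w u)"
      by (simp add: cdual_apply_scaleC_right linear_cmul[OF linear_cdual_apply] scaleR_conv_of_real)
    moreover have "?c * cdual_apply w u = of_real (norm (cdual_apply w u))"
      using False complex_norm_square[of "cdual_apply w u"]
      by (simp add: sgn_eq power2_eq_square divide_simps mult.commute)
    ultimately have "r / norm u * norm (cdual_apply w u) \<le> s * norm w"
      by simp
    then show ?thesis using u assms by (simp add: field_simps)
  qed
  then have "norm w \<le> s * norm w / r" using assms by (intro norm_cdual_le) auto
  moreover have "norm w > 0" using assms by simp
  ultimately show False using assms by (simp add: field_simps)
qed

text \<open>A finite system of equations in a normed space is treated as one equation between families of vectors;
the family space only has to be a real vector space for the Hahn-Banach theorem to apply.\<close>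

instantiation "fun" :: (type, real_vector) real_vector
begin

definition scaleR_fun :: "real \<Rightarrow> ('a \<Rightarrow> 'b) \<Rightarrow> 'a \<Rightarrow> 'b"
  where "scaleR_fun r f = (\<lambda>x. r *\<^sub>R f x)"

instance
  by standard (simp_all add: scaleR_fun_def fun_eq_iff algebra_simps)

end

text \<open>A finite system of linear equations with right-hand sides in \<open>X\<close> that is solvable in \<open>X\<^sup>*\<^sup>*\<close> is
approximately solvable in \<open>X\<close>, with almost no loss of norm. This weak form of the principle of local
reflexivity is a Goldstine-type statement: let \<open>p v\<close> be the least cost at which a family \<open>v\<close> of
right-hand sides can be approached, where both the size of the residual, weighted by \<open>1/\<delta>\<close>, and the
size of the candidate solution count. A candidate of cost below \<open>1\<close> is what is wanted. By Hahn-Banach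
there is a functional dominated by \<open>p\<close> that attains \<open>p b\<close> at \<open>b\<close>. Its domination by the residual cost
expresses it through elements \<open>y k\<close> of \<open>X\<^sup>*\<close>, and its domination by the size cost bounds the
transposed functionals \<open>w i\<close>. The given solution in \<open>X\<^sup>*\<^sup>*\<close> then shows that the value at \<open>b\<close>
is below \<open>1\<close>.\<close>

theorem approximate_local_reflexivity:
  fixes z :: "'i \<Rightarrow> 'a::complex_normed_vector cdual cdual"
    and a :: "'k \<Rightarrow> 'i \<Rightarrow> complex" and b :: "'k \<Rightarrow> 'a"
  assumes fin: "finite F" "finite M" and \<delta>: "\<delta> > 0"
    and rel: "\<And>k. k \<in> M \<Longrightarrow> (\<Sum>i\<in>F. a k i *\<^sub>C z i) = bidual_embed (b k)"
  obtains x where "\<And>i. i \<in> F \<Longrightarrow> norm (x i) \<le> norm (z i) + \<delta>"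
    and "\<And>k. k \<in> M \<Longrightarrow> norm ((\<Sum>i\<in>F. a k i *\<^sub>C x i) - b k) \<le> \<delta>"
proof -
  define L where "L x k = (\<Sum>i\<in>F. a k i *\<^sub>C x i)" for x :: "'i \<Rightarrow> 'a" and k
  have L_add: "L (x + y) k = L x k + L y k" for x y k
    by (simp add: L_def scaleC_add_right sum.distrib)
  have L_scale: "L (r *\<^sub>R x) k = r *\<^sub>R L x k" for r x k
    by (simp add: L_def scaleR_fun_def scaleR_sum_right linear_cmul[OF linear_scaleC])
  \<comment> \<open>\<open>t\<close> is an admissible cost of \<open>v\<close>: residual of the candidate \<open>x\<close> plus the dilation \<open>s\<close> that
    the required norm bounds need in order to hold for \<open>x\<close>.\<close>
  define R where "R v t \<longleftrightarrow> (\<exists>x s. 0 \<le> s \<and> (\<forall>i\<in>F. norm (x i) \<le> s * (norm (z i) + \<delta>)) \<and>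
    (\<Sum>k\<in>M. norm (v k - L x k)) / \<delta> + s \<le> t)" for v t
  define p where "p v = Inf {t. R v t}" for v
  have R_pos: "0 \<le> t" if R: "R v t" for v t
  proof -
    obtain x s where "0 \<le> s" "(\<Sum>k\<in>M. norm (v k - L x k)) / \<delta> + s \<le> t"
      using R R_def by auto
    moreover have "0 \<le> (\<Sum>k\<in>M. norm (v k - L x k)) / \<delta>"
      using \<delta> by (intro divide_nonneg_pos sum_nonneg) auto
    ultimately show ?thesis by linarith
  qed
  have bdd: "bdd_below {t. R v t}" for v
    using R_pos by (intro bdd_belowI[of _ 0]) auto
  have p_le: "p v \<le> t" if "R v t" for v t
    unfolding p_def by (rule cInf_lower) (use that bdd in auto)
  have R0: "R v ((\<Sum>k\<in>M. norm (v k)) / \<delta>)" for v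
    unfolding R_def by (intro exI[of _ "0 :: 'i \<Rightarrow> 'a"] exI[of _ "0::real"])
      (simp add: L_def linear_0[OF linear_scaleC])
  have R_L: "R (L x) 1" if "\<forall>i\<in>F. norm (x i) \<le> norm (z i) + \<delta>" for x
    unfolding R_def by (intro exI[of _ x] exI[of _ "1::real"]) (use that in simp)
  have "sublinear p"
    unfolding p_def
  proof (rule sublinear_Inf_cone)
    fix u v s t assume "R u s" "R v t"
    then obtain x y c d where x: "0 \<le> c" "\<forall>i\<in>F. norm (x i) \<le> c * (norm (z i) + \<delta>)"
        "(\<Sum>k\<in>M. norm (u k - L x k)) / \<delta> + c \<le> s"
      and y: "0 \<le> d" "\<forall>i\<in>F. norm (y i) \<le> d * (norm (z i) + \<delta>)"
        "(\<Sum>k\<in>M. norm (v k - L y k)) / \<delta> + d \<le> t"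
      unfolding R_def by blast
    have "norm ((x + y) i) \<le> (c + d) * (norm (z i) + \<delta>)" if "i \<in> F" for i
      using x(2) y(2) that norm_triangle_ineq[of "x i" "y i"] by (fastforce simp: distrib_right)
    moreover have "(\<Sum>k\<in>M. norm ((u + v) k - L (x + y) k))
        \<le> (\<Sum>k\<in>M. norm (u k - L x k)) + (\<Sum>k\<in>M. norm (v k - L y k))"
      unfolding sum.distrib[symmetric]
      by (intro sum_mono) (simp add: L_add norm_diff_triangle_ineq)
    then have "(\<Sum>k\<in>M. norm ((u + v) k - L (x + y) k)) / \<delta> + (c + d) \<le> s + t"
      using x(3) y(3) \<delta> by (simp add: field_simps)
    ultimately show "R (u + v) (s + t)"
      unfolding R_def using x(1) y(1) by (intro exI[of _ "x + y"] exI[of _ "c + d"]) auto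
  next
    fix r v t assume r: "(r::real) > 0" and "R v t"
    then obtain x c where x: "0 \<le> c" "\<forall>i\<in>F. norm (x i) \<le> c * (norm (z i) + \<delta>)"
        "(\<Sum>k\<in>M. norm (v k - L x k)) / \<delta> + c \<le> t"
      unfolding R_def by blast
    have "norm ((r *\<^sub>R x) i) \<le> (r * c) * (norm (z i) + \<delta>)" if "i \<in> F" for i
      using x(2) that r by (simp add: scaleR_fun_def mult.assoc)
    moreover have "norm ((r *\<^sub>R v) k - L (r *\<^sub>R x) k) = r * norm (v k - L x k)" for k
    proof -
      have "(r *\<^sub>R v) k - L (r *\<^sub>R x) k = r *\<^sub>R (v k - L x k)"
        by (simp add: L_scale scaleR_diff_right) (simp add: scaleR_fun_def)
      then show ?thesis using r by simp
    qed
    then have "(\<Sum>k\<in>M. norm ((r *\<^sub>R v) k - L (r *\<^sub>R x) k)) / \<delta> + r * c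
        = r * ((\<Sum>k\<in>M. norm (v k - L x k)) / \<delta> + c)"
      by (simp add: algebra_simps flip: sum_distrib_left)
    ultimately show "R (r *\<^sub>R v) (r * t)"
      unfolding R_def using x(1,3) r by (intro exI[of _ "r *\<^sub>R x"] exI[of _ "r * c"]) auto
  qed (use R0 bdd in auto)
  then obtain l where l: "linear l" "\<And>v. l v \<le> p v" "l b = p b"
    using Hahn_Banach_sublinear by blast
  have l_bd: "l v \<le> (\<Sum>k\<in>M. norm (v k)) / \<delta>" for v
    using l(2)[of v] p_le[OF R0] by (rule order_trans)
  \<comment> \<open>Only the coordinates in \<open>M\<close> contribute to the residual, so \<open>l\<close> depends on these alone.\<close>
  define e where "e k u = (\<lambda>j. if j = k then u else (0::'a))" for k :: 'k and u
  have "\<exists>y :: 'a cdual. \<forall>u. Re (cdual_apply y u) = l (e k u)" if k: "k \<in> M" for k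
  proof -
    have "linear (\<lambda>u. l (e k u))"
    proof (rule linearI)
      have "e k (u + v) = e k u + e k v" for u v by (auto simp: e_def fun_eq_iff)
      then show "l (e k (u + v)) = l (e k u) + l (e k v)" for u v
        by (simp add: linear_add[OF l(1)])
      have "e k (r *\<^sub>R u) = r *\<^sub>R e k u" for r u by (auto simp: e_def fun_eq_iff scaleR_fun_def)
      then show "l (e k (r *\<^sub>R u)) = r *\<^sub>R l (e k u)" for r u
        by (simp add: linear_cmul[OF l(1)])
    qed
    moreover have "l (e k u) \<le> (1 / \<delta>) * norm u" for u
    proof -
      have "(\<Sum>j\<in>M. norm (e k u j)) = norm u"
        using fin(2) k by (simp add: e_def if_distrib[of norm] sum.delta cong: if_cong)
      then show ?thesis using l_bd[of "e k u"] by simp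
    qed
    ultimately show ?thesis using cdual_with_real_part by blast
  qed
  then obtain y :: "'k \<Rightarrow> 'a cdual" where y: "\<And>k u. k \<in> M \<Longrightarrow> Re (cdual_apply (y k) u) = l (e k u)"
    by metis
  have l_eq: "l v = Re (\<Sum>k\<in>M. cdual_apply (y k) (v k))" for v
  proof -
    define v' where "v' = (\<Sum>k\<in>M. e k (v k))"
    have sum_at: "(\<Sum>k\<in>A. h k) j = (\<Sum>k\<in>A. h k j)" if "finite A" for h :: "'k \<Rightarrow> 'k \<Rightarrow> 'a" and A j
      using that by (induction A) auto
    have v': "v' j = v j" if "j \<in> M" for j
      using fin(2) that by (simp add: v'_def sum_at e_def)
    have "l (v - v') \<le> 0" "l (v' - v) \<le> 0"
      using l_bd[of "v - v'"] l_bd[of "v' - v"] v' by simp_all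
    then have "l v = l v'" by (simp add: linear_diff[OF l(1)])
    also have "\<dots> = (\<Sum>k\<in>M. l (e k (v k)))" unfolding v'_def by (rule linear_sum[OF l(1)])
    finally show ?thesis by (simp add: y)
  qed
  \<comment> \<open>the transpose of \<open>L\<close> applied to \<open>y\<close>\<close>
  define w where "w i = (\<Sum>k\<in>M. a k i *\<^sub>C y k)" for i
  have l_L: "l (L x) = (\<Sum>i\<in>F. Re (cdual_apply (w i) (x i)))" for x
  proof -
    have "(\<Sum>k\<in>M. cdual_apply (y k) (L x k)) = (\<Sum>k\<in>M. \<Sum>i\<in>F. a k i * cdual_apply (y k) (x i))"
      by (simp add: L_def linear_sum[OF linear_cdual_apply] cdual_apply_scaleC_right)
    also have "\<dots> = (\<Sum>i\<in>F. \<Sum>k\<in>M. a k i * cdual_apply (y k) (x i))" by (rule sum.swap)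
    also have "\<dots> = (\<Sum>i\<in>F. cdual_apply (w i) (x i))"
      by (simp add: w_def cdual_apply_sum cdual_apply_scaleC)
    finally show ?thesis by (simp add: l_eq)
  qed
  have l_b: "l b = (\<Sum>i\<in>F. Re (cdual_apply (z i) (w i)))"
  proof -
    have "(\<Sum>i\<in>F. cdual_apply (z i) (w i)) = (\<Sum>i\<in>F. \<Sum>k\<in>M. a k i * cdual_apply (z i) (y k))"
      by (simp add: w_def linear_sum[OF linear_cdual_apply] cdual_apply_scaleC_right)
    also have "\<dots> = (\<Sum>k\<in>M. \<Sum>i\<in>F. a k i * cdual_apply (z i) (y k))" by (rule sum.swap)
    also have "\<dots> = (\<Sum>k\<in>M. cdual_apply (\<Sum>i\<in>F. a k i *\<^sub>C z i) (y k))"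
      by (simp add: cdual_apply_sum cdual_apply_scaleC)
    also have "\<dots> = (\<Sum>k\<in>M. cdual_apply (y k) (b k))"
      by (simp add: rel bidual_embed.rep_eq)
    finally show ?thesis by (simp add: l_eq flip: Re_sum)
  qed
  \<comment> \<open>The margin \<open>\<delta>\<close> in the norm bounds makes the estimate strict as soon as some \<open>w i\<close> is nonzero.\<close>
  have "\<exists>x. norm x \<le> norm (z i) + \<delta> \<and> norm (z i) * norm (w i) \<le> Re (cdual_apply (w i) x) \<and>
      (w i \<noteq> 0 \<longrightarrow> norm (z i) * norm (w i) < Re (cdual_apply (w i) x))" for i
  proof (cases "w i = 0")
    case True
    then show ?thesis using \<delta> by (intro exI[of _ 0]) (auto simp: cdual_apply_zero)
  next
    case False
    then show ?thesis using \<delta> cdual_norming_vector[of "w i" "norm (z i)" "norm (z i) + \<delta>"]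
      by (metis less_add_same_cancel1 less_imp_le norm_ge_zero)
  qed
  then obtain x where x: "\<And>i. norm (x i) \<le> norm (z i) + \<delta>"
    "\<And>i. norm (z i) * norm (w i) \<le> Re (cdual_apply (w i) (x i))"
    "\<And>i. w i \<noteq> 0 \<Longrightarrow> norm (z i) * norm (w i) < Re (cdual_apply (w i) (x i))"
    by metis
  have le1: "(\<Sum>i\<in>F. Re (cdual_apply (w i) (x i))) \<le> 1"
    using l(2)[of "L x"] p_le[OF R_L, of x] x(1) by (simp add: l_L)
  have "l b \<le> (\<Sum>i\<in>F. norm (z i) * norm (w i))"
    unfolding l_b by (intro sum_mono order_trans[OF complex_Re_le_cmod norm_cdual_apply_le])
  also have "\<dots> < 1"
  proof (cases "\<exists>i\<in>F. w i \<noteq> 0")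
    case True
    then have "(\<Sum>i\<in>F. norm (z i) * norm (w i)) < (\<Sum>i\<in>F. Re (cdual_apply (w i) (x i)))"
      using x fin(1) by (intro sum_strict_mono_ex1) auto
    then show ?thesis using le1 by simp
  qed simp
  finally have "p b < 1" using l(3) by simp
  then obtain t where "R b t" "t < 1"
    unfolding p_def using cInf_lessD[of "{t. R b t}" 1] R0 by auto
  then obtain x s where xs: "0 \<le> s" "\<forall>i\<in>F. norm (x i) \<le> s * (norm (z i) + \<delta>)"
    "(\<Sum>k\<in>M. norm (b k - L x k)) / \<delta> + s < 1"
    unfolding R_def by (meson le_less_trans)
  show ?thesis
  proof
    have ge: "0 \<le> (\<Sum>k\<in>M. norm (b k - L x k)) / \<delta>"
      using \<delta> by (intro divide_nonneg_pos sum_nonneg) auto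
    then have "s \<le> 1" using xs(3) by linarith
    then show "norm (x i) \<le> norm (z i) + \<delta>" if "i \<in> F" for i
      using xs(2) that \<delta> mult_right_mono[of s 1 "norm (z i) + \<delta>"] by fastforce
    have "(\<Sum>k\<in>M. norm (b k - L x k)) / \<delta> \<le> 1" using xs(1,3) by linarith
    then have "(\<Sum>k\<in>M. norm (b k - L x k)) \<le> \<delta>" using \<delta> by (simp add: field_simps)
    then show "norm ((\<Sum>i\<in>F. a k i *\<^sub>C x i) - b k) \<le> \<delta>" if "k \<in> M" for k
      using member_le_sum[OF that _ fin(2), of "\<lambda>k. norm (b k - L x k)"]
      by (simp add: L_def norm_minus_commute)
  qed
qed

section \<open>First-order estimates for holomorphic Lipschitz functions\<close>

lemma deriv_norm_le_lipschitz:
  fixes \<phi> :: "complex \<Rightarrow> complex"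
  assumes hol: "\<phi> holomorphic_on ball 0 R" and R: "R > 0"
    and lip: "\<And>u v. u \<in> ball 0 R \<Longrightarrow> v \<in> ball 0 R \<Longrightarrow> norm (\<phi> u - \<phi> v) \<le> K * norm (u - v)"
  shows "norm (deriv \<phi> 0) \<le> K"
proof (rule Lim_norm_ubound)
  show "((\<lambda>h. (\<phi> (0 + h) - \<phi> 0) / h) \<longlongrightarrow> deriv \<phi> 0) (at 0)"
    unfolding DERIV_def[symmetric] by (rule holomorphic_derivI[OF hol open_ball]) (use R in simp)
  have "\<forall>\<^sub>F h in at 0. h \<in> ball (0::complex) R \<and> h \<noteq> 0"
    using R eventually_at_ball[OF R, of "0::complex" UNIV]
    by (auto simp: eventually_at_filter elim!: eventually_mono)
  then show "\<forall>\<^sub>F h in at 0. norm ((\<phi> (0 + h) - \<phi> 0) / h) \<le> K"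
  proof eventually_elim
    case (elim h)
    then show ?case using lip[of h 0] R by (simp add: norm_divide divide_le_eq)
  qed
qed simp

text \<open>The difference quotient of \<open>\<phi>\<close> at \<open>0\<close> extends holomorphically over \<open>0\<close> and is bounded by \<open>K\<close>, so the
Schwarz lemma on the disc of radius \<open>R\<close> bounds its variation between \<open>0\<close> and \<open>1\<close> by \<open>4K/R\<close>.\<close>

lemma lipschitz_first_order_error:
  fixes \<phi> :: "complex \<Rightarrow> complex"
  assumes hol: "\<phi> holomorphic_on ball 0 R" and R: "R > 1" and K: "K > 0"
    and lip: "\<And>u v. u \<in> ball 0 R \<Longrightarrow> v \<in> ball 0 R \<Longrightarrow> norm (\<phi> u - \<phi> v) \<le> K * norm (u - v)"
  shows "norm (\<phi> 1 - \<phi> 0 - deriv \<phi> 0) \<le> 4 * K / R"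
proof -
  define \<psi> where "\<psi> u = (if u = 0 then deriv \<phi> 0 else (\<phi> u - \<phi> 0) / (u - 0))" for u
  have hol\<psi>: "\<psi> holomorphic_on ball 0 R"
    unfolding \<psi>_def by (rule pole_lemma_open[OF hol open_ball])
  have \<psi>_le: "norm (\<psi> u) \<le> K" if "u \<in> ball 0 R" for u
    using that lip[OF that, of 0] deriv_norm_le_lipschitz[OF hol _ lip] R
    by (auto simp: \<psi>_def norm_divide divide_le_eq)
  \<comment> \<open>Division by \<open>4K\<close> rather than \<open>2K\<close> gives the strict bound that the Schwarz lemma asks for.\<close>
  define \<eta> where "\<eta> \<zeta> = (\<psi> (of_real R * \<zeta>) - \<psi> 0) / of_real (4 * K)" for \<zeta>
  have in_ball: "of_real R * \<zeta> \<in> ball 0 R" if "norm \<zeta> < 1" for \<zeta> :: complex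
    using that R by (simp add: norm_mult)
  have "norm (\<eta> (of_real (1 / R))) \<le> norm (of_real (1 / R) :: complex)"
  proof (rule Schwarz_Lemma(1))
    have "(\<lambda>\<zeta>. \<psi> (of_real R * \<zeta>)) holomorphic_on ball 0 1"
      by (rule holomorphic_on_compose_gen[OF _ hol\<psi>, unfolded o_def])
        (use in_ball in \<open>auto intro!: holomorphic_intros\<close>)
    then show "\<eta> holomorphic_on ball 0 1"
      unfolding \<eta>_def using K by (intro holomorphic_intros) auto
    show "norm (\<eta> \<zeta>) < 1" if "norm \<zeta> < 1" for \<zeta>
    proof -
      have "norm (\<psi> (of_real R * \<zeta>) - \<psi> 0) \<le> K + K"
        using \<psi>_le[OF in_ball[OF that]] \<psi>_le[of 0] R by (intro norm_triangle_le_diff) auto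
      then show ?thesis using K by (simp add: \<eta>_def norm_divide norm_mult divide_less_eq)
    qed
    show "norm (of_real (1 / R) :: complex) < 1" using R by (simp add: norm_divide)
  qed (simp add: \<eta>_def)
  then have "norm (\<psi> 1 - \<psi> 0) \<le> 4 * K / R"
    using R K by (simp add: \<eta>_def norm_divide norm_mult field_simps)
  then show ?thesis by (simp add: \<psi>_def)
qed

lemma line_restriction:
  fixes f :: "'a::complex_normed_vector \<Rightarrow> complex"
  assumes hol: "cholomorphic_on f (ball 0 1)" and lip: "K-lipschitz_on (ball 0 1) f"
    and x: "x \<in> ball 0 1" and w: "w \<noteq> 0" and D: "bounded_clinear D" "(f has_derivative D) (at x)"
  defines "R \<equiv> (1 - norm x) / norm w" and "\<phi> \<equiv> \<lambda>c. f (x + c *\<^sub>C w)"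
  shows "\<phi> holomorphic_on ball 0 R" "deriv \<phi> 0 = D w"
    and "\<And>u v. u \<in> ball 0 R \<Longrightarrow> v \<in> ball 0 R \<Longrightarrow>
      norm (\<phi> u - \<phi> v) \<le> (K * norm w) * norm (u - v)"
proof -
  have in_ball: "x + u *\<^sub>C w \<in> ball 0 1" if "u \<in> ball 0 R" for u
  proof -
    have "norm u * norm w < 1 - norm x" using that w by (simp add: R_def field_simps)
    then show ?thesis
      using norm_triangle_ineq[of x "u *\<^sub>C w"] by (simp add: norm_scaleC)
  qed
  have scale_diff: "u *\<^sub>C w - v *\<^sub>C w = (u - v) *\<^sub>C w" for u v
    using scaleC_add_left[of "u - v" v w] by simp
  have line: "((\<lambda>u. x + u *\<^sub>C w) has_derivative (\<lambda>u. u *\<^sub>C w)) (at u)" for u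
  proof -
    have "bounded_linear (\<lambda>u. u *\<^sub>C w)"
    proof (rule bounded_linear_intro[where K = "norm w"])
      show "(r *\<^sub>R u) *\<^sub>C w = r *\<^sub>R u *\<^sub>C w" for r u
        unfolding scaleR_conv_of_real[of r u] scaleC_scaleC[symmetric] by (rule scaleC_of_real)
    qed (simp_all add: scaleC_add_left norm_scaleC)
    then show ?thesis
      using has_derivative_add[OF has_derivative_const[of x]
          bounded_linear.has_derivative[OF _ has_derivative_ident]]
      by simp
  qed
  have der: "(\<phi> has_field_derivative E w) (at u)"
    if "(f has_derivative E) (at (x + u *\<^sub>C w))" "bounded_clinear E" for E u
  proof -
    have "(\<phi> has_derivative (\<lambda>h. E (h *\<^sub>C w))) (at u)"
      unfolding \<phi>_def by (rule has_derivative_compose[OF line that(1)])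
    moreover have "(\<lambda>h. E (h *\<^sub>C w)) = (*) (E w)"
      using bounded_clinear_scaleC[OF that(2)] by (auto simp: scaleC_complex_def)
    ultimately show ?thesis by (simp add: has_field_derivative_def)
  qed
  show "\<phi> holomorphic_on ball 0 R"
    unfolding holomorphic_on_open[OF open_ball]
  proof
    fix u :: complex assume "u \<in> ball 0 R"
    then obtain E where "bounded_clinear E" "(f has_derivative E) (at (x + u *\<^sub>C w))"
      using hol in_ball unfolding cholomorphic_on_def by blast
    then show "\<exists>f'. (\<phi> has_field_derivative f') (at u)" using der by blast
  qed
  have "0 *\<^sub>C w = 0" using scaleC_of_real[of 0 w] by simp
  then show "deriv \<phi> 0 = D w"
    using der[of D 0] D by (intro DERIV_imp_deriv) simp
  show "norm (\<phi> u - \<phi> v) \<le> (K * norm w) * norm (u - v)" if "u \<in> ball 0 R" "v \<in> ball 0 R" for u v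
  proof -
    have "norm (\<phi> u - \<phi> v) \<le> K * norm ((x + u *\<^sub>C w) - (x + v *\<^sub>C w))"
      using lipschitz_onD[OF lip in_ball in_ball, OF that] by (simp add: \<phi>_def dist_norm)
    then show ?thesis by (simp add: scale_diff norm_scaleC mult.commute mult.left_commute)
  qed
qed

lemma lipschitz_derivative_le:
  fixes f :: "'a::complex_normed_vector \<Rightarrow> complex"
  assumes hol: "cholomorphic_on f (ball 0 1)" and lip: "K-lipschitz_on (ball 0 1) f"
    and x: "x \<in> ball 0 1" and D: "bounded_clinear D" "(f has_derivative D) (at x)"
  shows "norm (D w) \<le> K * norm w"
proof (cases "w = 0")
  case True
  then show ?thesis
    using linear_0[OF bounded_linear.linear[OF bounded_clinear_imp_bounded_linear[OF D(1)]]] by simp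
next
  case False
  note r = line_restriction[OF hol lip x False D]
  show ?thesis
    using deriv_norm_le_lipschitz[OF r(1) _ r(3)] x False by (simp add: r(2))
qed

text \<open>The point of this estimate is that its bound is uniform: apart from \<open>w\<close>, it depends only on \<open>K\<close> and on
the distance of \<open>x\<close> to the sphere, so the estimate survives pointwise limits.\<close>

lemma lipschitz_first_order_error_ball:
  fixes f :: "'a::complex_normed_vector \<Rightarrow> complex"
  assumes hol: "cholomorphic_on f (ball 0 1)" and lip: "K-lipschitz_on (ball 0 1) f" and K: "K > 0"
    and D: "bounded_clinear D" "(f has_derivative D) (at x)" and xw: "norm x + norm w < 1"
  shows "norm (f (x + w) - f x - D w) \<le> 4 * K * (norm w)\<^sup>2 / (1 - norm x)"
proof (cases "w = 0")
  case True
  then show ?thesis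
    using linear_0[OF bounded_linear.linear[OF bounded_clinear_imp_bounded_linear[OF D(1)]]] by simp
next
  case False
  then have x: "x \<in> ball 0 1" using xw norm_ge_zero[of w] by (simp del: norm_ge_zero)
  note r = line_restriction[OF hol lip x False D]
  have "1 *\<^sub>C w = w" "0 *\<^sub>C w = 0" using scaleC_of_real[of 1 w] scaleC_of_real[of 0 w] by simp_all
  then have "norm (f (x + w) - f x - D w) \<le> 4 * (K * norm w) / ((1 - norm x) / norm w)"
    using lipschitz_first_order_error[OF r(1) _ _ r(3)] xw False K by (simp add: r(2))
  then show ?thesis by (simp add: power2_eq_square mult.assoc)
qed

lemma has_derivative_of_quadratic_error:
  fixes f :: "'a::real_normed_vector \<Rightarrow> 'b::real_normed_vector"
  assumes D: "bounded_linear D" and r: "r > 0"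
    and err: "\<And>h. norm h < r \<Longrightarrow> norm (f (x + h) - f x - D h) \<le> C * (norm h)\<^sup>2"
  shows "(f has_derivative D) (at x)"
  unfolding has_derivative_at
proof
  have "\<forall>\<^sub>F h in at 0. h \<in> ball (0::'a) r \<and> h \<noteq> 0"
    using r eventually_at_ball[OF r, of "0::'a" UNIV]
    by (auto simp: eventually_at_filter elim!: eventually_mono)
  then have "\<forall>\<^sub>F h in at 0. norm (norm (f (x + h) - f x - D h) / norm h) \<le> C * norm h"
  proof eventually_elim
    case (elim h)
    then show ?case using err[of h] by (simp add: divide_le_eq power2_eq_square mult.assoc)
  qed
  then show "((\<lambda>h. norm (f (x + h) - f x - D h) / norm h) \<longlongrightarrow> 0) (at 0)"
    by (rule Lim_null_comparison) (auto intro!: tendsto_eq_intros)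
qed (rule D)

section \<open>A filter of asymptotically linear retractions of the bidual\<close>

text \<open>This replaces limits along an ultrafilter. By Tychonoff, the map that sends \<open>T\<close> to the family of the
suitably truncated values \<open>\<phi> T\<close> has a cluster point along \<open>F\<close>, where \<open>\<phi>\<close> runs through all complex
functions at once.\<close>

lemma exists_finer_filter_with_limits:
  fixes F :: "'t filter"
  assumes F: "F \<noteq> bot"
  obtains G where "G \<le> F" "G \<noteq> bot"
    "\<And>(\<phi> :: 't \<Rightarrow> complex) B. \<forall>\<^sub>F T in F. norm (\<phi> T) \<le> B \<Longrightarrow> \<exists>l. (\<phi> \<longlongrightarrow> l) G"
proof -
  define R where "R \<phi> = (SOME B. \<forall>\<^sub>F T in F. norm (\<phi> T) \<le> B)" for \<phi> :: "'t \<Rightarrow> complex"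
  \<comment> \<open>Each \<open>\<phi>\<close> is truncated at its own bound, since infinitely many bounds need not hold
    simultaneously for any single \<open>T\<close>.\<close>
  define \<Psi> where "\<Psi> T \<phi> = (if norm (\<phi> T) \<le> R \<phi> then \<phi> T else 0)" for T and \<phi> :: "'t \<Rightarrow> complex"
  let ?U = "PiE UNIV (\<lambda>\<phi>. cball (0::complex) (max 0 (R \<phi>)))"
  have "compactin (product_topology (\<lambda>_. euclidean) UNIV) ?U"
    unfolding compactin_PiE by simp
  then have "compact ?U"
    by (simp add: euclidean_product_topology)
  moreover have "\<Psi> T \<in> ?U" for T by (auto simp: \<Psi>_def PiE_UNIV_domain)
  then have "\<forall>\<^sub>F y in filtermap \<Psi> F. y \<in> ?U"
    by (simp add: eventually_filtermap)
  ultimately obtain g where g: "inf (nhds g) (filtermap \<Psi> F) \<noteq> bot"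
    using F unfolding compact_filter by (metis filtermap_bot_iff)
  show ?thesis
  proof
    let ?G = "inf F (filtercomap \<Psi> (nhds g))"
    show "?G \<le> F" by simp
    show "?G \<noteq> bot"
    proof
      assume "?G = bot"
      then obtain P Q where PQ: "eventually P F" "eventually Q (filtercomap \<Psi> (nhds g))"
        "\<And>T. P T \<Longrightarrow> Q T \<Longrightarrow> False"
        unfolding trivial_limit_def eventually_inf by auto
      then obtain S where S: "eventually S (nhds g)" "\<And>T. S (\<Psi> T) \<Longrightarrow> Q T"
        unfolding eventually_filtercomap by auto
      have "\<forall>\<^sub>F y in filtermap \<Psi> F. \<not> S y"
        unfolding eventually_filtermap using PQ(1) by (rule eventually_mono) (use PQ S in blast)
      then have "\<forall>\<^sub>F y in inf (nhds g) (filtermap \<Psi> F). False"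
        unfolding eventually_inf using S(1) by blast
      then show False using g by (simp add: trivial_limit_def)
    qed
    have lim: "(\<Psi> \<longlongrightarrow> g) ?G"
      by (simp add: filterlim_iff_le_filtercomap)
    show "\<exists>l. (\<phi> \<longlongrightarrow> l) ?G" if ev: "\<forall>\<^sub>F T in F. norm (\<phi> T) \<le> B" for \<phi> :: "'t \<Rightarrow> complex" and B
    proof
      have "((\<lambda>T. \<Psi> T \<phi>) \<longlongrightarrow> g \<phi>) ?G"
        by (rule continuous_on_tendsto_compose[OF continuous_on_product_coordinates[of \<phi>] lim]) auto
      moreover have "\<forall>\<^sub>F T in F. norm (\<phi> T) \<le> R \<phi>"
        unfolding R_def using ev by (rule someI)
      then have "\<forall>\<^sub>F T in ?G. \<Psi> T \<phi> = \<phi> T"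
        by (rule filter_leD[rotated, OF eventually_mono]) (auto simp: \<Psi>_def)
      ultimately show "(\<phi> \<longlongrightarrow> g \<phi>) ?G"
        by (rule Lim_transform_eventually)
    qed
  qed
qed

lemma sum_relation_coefficients:
  assumes "finite F" "u \<in> F" "z \<in> F" "w \<in> F"
  shows "(\<Sum>i\<in>F. (of_bool (i = u) - c * of_bool (i = z) - of_bool (i = w)) *\<^sub>C h i)
    = h u - c *\<^sub>C h z - h w"
proof -
  have "(of_bool (i = u) - c * of_bool (i = z) - of_bool (i = w)) *\<^sub>C h i
    = (if i = u then h i else 0) - (if i = z then c *\<^sub>C h i else 0) - (if i = w then h i else 0)" for i
    by (auto simp: scaleC_diff_left scaleC_one scaleC_zero_left)
  then show ?thesis using assms by (simp add: sum_subtractf sum.delta)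
qed

text \<open>Along \<open>F\<close> the maps \<open>T\<close> from \<open>X\<^sup>*\<^sup>*\<close> to \<open>X\<close> behave in the limit like a linear contraction that is the
identity on \<open>X\<close>, although no such map need exist. The last conclusion combines additivity,
homogeneity and the identity on \<open>X\<close> in one relation. Finitely many instances of it, up to an error,
form a finite linear system for the values of \<open>T\<close>, which the identity of \<open>X\<^sup>*\<^sup>*\<close> solves exactly;
approximate local reflexivity moves the solution into \<open>X\<close>.\<close>

theorem almost_linear_retractions:
  obtains F :: "('a::complex_normed_vector cdual cdual \<Rightarrow> 'a) filter" where "F \<noteq> bot"
    "\<And>\<delta>. \<delta> > 0 \<Longrightarrow> \<forall>\<^sub>F T in F. \<forall>z. norm (T z) \<le> norm z + \<delta>"
    "\<And>c z w x. ((\<lambda>T. T (c *\<^sub>C z + w + bidual_embed x) - c *\<^sub>C T z - T w - x) \<longlongrightarrow> 0) F"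
proof -
  define S where "S = (\<lambda>(c, z, w, x, \<delta>). {T :: 'a cdual cdual \<Rightarrow> 'a. (\<forall>z. norm (T z) \<le> norm z + \<delta>) \<and>
    norm (T (c *\<^sub>C z + w + bidual_embed x) - c *\<^sub>C T z - T w - x) \<le> \<delta>})"
  define I where "I = {(c :: complex, z :: 'a cdual cdual, w :: 'a cdual cdual, x :: 'a, \<delta> :: real). \<delta> > 0}"
  define F where "F = (INF k\<in>I. principal (S k))"
  have ev: "eventually (\<lambda>T. T \<in> S k) F" if "k \<in> I" for k
    unfolding F_def by (rule eventually_INF1[OF that]) (simp add: eventually_principal)
  have "F \<noteq> bot"
    unfolding F_def
  proof (rule INF_filter_not_bot)
    fix X assume X: "X \<subseteq> I" "finite X"
    define \<delta> where "\<delta> = Min (insert 1 ((\<lambda>(c, z, w, x, \<delta>). \<delta>) ` X))"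
    have \<delta>_pos: "\<delta> > 0"
      unfolding \<delta>_def using X by (subst Min_gr_iff) (auto simp: I_def)
    have \<delta>_le: "\<delta> \<le> d" if "(c, z, w, x, d) \<in> X" for c z w x d
      unfolding \<delta>_def using that X(2) by (intro Min_le) force+
    \<comment> \<open>the points at which the finitely many relations evaluate \<open>T\<close>\<close>
    define E where "E = (\<Union>(c, z, w, x, \<delta>)\<in>X. {c *\<^sub>C z + w + bidual_embed x, z, w})"
    have fin: "finite E" unfolding E_def using X(2) by (intro finite_UN_I) auto
    define a where "a = (\<lambda>(c, z, w, x :: 'a, \<delta> :: real) i. of_bool (i = c *\<^sub>C z + w + bidual_embed x)
      - c * of_bool (i = z) - (of_bool (i = w) :: complex))"
    define b where "b = (\<lambda>(c :: complex, z :: 'a cdual cdual, w :: 'a cdual cdual, x :: 'a, \<delta> :: real). x)"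
    have E: "c *\<^sub>C z + w + bidual_embed x \<in> E" "z \<in> E" "w \<in> E" if "(c, z, w, x, d) \<in> X" for c z w x d
      unfolding E_def using that by (auto intro!: bexI[OF _ that])
    have sum_a: "(\<Sum>i\<in>E. a (c, z, w, x, d) i *\<^sub>C h i) = h (c *\<^sub>C z + w + bidual_embed x) - c *\<^sub>C h z - h w"
      if "(c, z, w, x, d) \<in> X" for c z w x d and h :: "'a cdual cdual \<Rightarrow> 'b::complex_normed_vector"
      unfolding a_def using sum_relation_coefficients[OF fin E[OF that]] by simp
    have rel: "(\<Sum>i\<in>E. a k i *\<^sub>C i) = bidual_embed (b k)" if "k \<in> X" for k
    proof -
      obtain c z w x d where k: "k = (c, z, w, x, d)" by (cases k)
      show ?thesis using sum_a[of c z w x d "\<lambda>i. i"] that by (simp add: k b_def)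
    qed
    obtain t where t: "\<And>i. i \<in> E \<Longrightarrow> norm (t i) \<le> norm i + \<delta>"
      "\<And>k. k \<in> X \<Longrightarrow> norm ((\<Sum>i\<in>E. a k i *\<^sub>C t i) - b k) \<le> \<delta>"
      using approximate_local_reflexivity[where z = "\<lambda>i. i" and a = a and b = b, OF fin X(2) \<delta>_pos rel] by blast
    define T where "T i = (if i \<in> E then t i else 0)" for i
    have "T \<in> S k" if k: "k \<in> X" for k
    proof -
      obtain c z w x d where k_eq: "k = (c, z, w, x, d)" by (cases k)
      have in_X: "(c, z, w, x, d) \<in> X" using k k_eq by simp
      have "norm (T i) \<le> norm i + d" for i
        using t(1)[of i] \<delta>_le[OF in_X] \<delta>_pos norm_ge_zero[of i]
        by (auto simp: T_def simp del: norm_ge_zero)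
      moreover have "norm (T (c *\<^sub>C z + w + bidual_embed x) - c *\<^sub>C T z - T w - x) \<le> d"
        using t(2)[OF in_X] \<delta>_le[OF in_X] E[OF in_X] by (simp add: sum_a[OF in_X] b_def T_def)
      ultimately show ?thesis by (simp add: S_def k_eq)
    qed
    then have "T \<in> (\<Inter>k\<in>X. S k)" by blast
    then show "(INF k\<in>X. principal (S k)) \<noteq> bot"
      by (auto simp: INF_principal_finite[OF X(2)] principal_eq_bot_iff)
  qed
  moreover have "\<forall>\<^sub>F T in F. \<forall>z. norm (T z) \<le> norm z + \<delta>" if "\<delta> > 0" for \<delta>
    using ev[of "(0, 0, 0, 0, \<delta>)"] that by (auto simp: S_def I_def elim!: eventually_mono)
  moreover have "((\<lambda>T. T (c *\<^sub>C z + w + bidual_embed x) - c *\<^sub>C T z - T w - x) \<longlongrightarrow> 0) F" for c z w x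
  proof (rule tendstoI)
    fix e :: real assume "e > 0"
    then show "\<forall>\<^sub>F T in F. dist (T (c *\<^sub>C z + w + bidual_embed x) - c *\<^sub>C T z - T w - x) 0 < e"
      using ev[of "(c, z, w, x, e / 2)"] by (auto simp: S_def I_def elim!: eventually_mono)
  qed
  ultimately show ?thesis by (rule that)
qed

section \<open>Norm-preserving extension to the bidual\<close>

text \<open>With the maps \<open>T\<close> of the previous section, the extension of \<open>f\<close> is \<open>g z = lim f (T z)\<close>. The Lipschitz
bound and the values on \<open>X\<close> pass to the limit at once. For holomorphy, the limit
\<open>E z w = lim Df(T z)(T w)\<close> is taken along with it: it is complex linear in \<open>w\<close>, and the uniform
first-order error estimate for \<open>f\<close> passes to the limit and shows that \<open>E z\<close> is the derivative of
\<open>g\<close> at \<open>z\<close>.\<close>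

theorem hl0_norm_preserving_extension:
  fixes f :: "'a::complex_normed_vector hl0"
  obtains g :: "'a cdual cdual hl0" where "hl0_restrict g = f" "norm g \<le> norm f"
proof -
  define \<phi> where "\<phi> = hl0_apply f"
  define K where "K = norm f"
  obtain C where hol: "cholomorphic_on \<phi> (ball 0 1)" and C: "C-lipschitz_on (ball 0 1) \<phi>"
    and \<phi>0: "\<phi> 0 = 0" and \<phi>_out: "\<And>x. x \<notin> ball 0 1 \<Longrightarrow> \<phi> x = 0"
    using hl0_apply[of f] unfolding \<phi>_def by blast
  have K_eq: "K = lip_const \<phi>" by (simp add: K_def \<phi>_def norm_hl0.rep_eq)
  have K0: "K \<ge> 0" by (simp add: K_def)
  have \<phi>_lip: "norm (\<phi> x - \<phi> y) \<le> K * norm (x - y)" if "x \<in> ball 0 1" "y \<in> ball 0 1" for x y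
    unfolding K_eq using lip_const_upper[OF C that] .
  \<comment> \<open>The constant \<open>K + 1\<close> is used where the Lipschitz constant has to be positive.\<close>
  have lip: "(K + 1)-lipschitz_on (ball 0 1) \<phi>"
  proof (rule lipschitz_onI)
    fix x y :: 'a assume "x \<in> ball 0 1" "y \<in> ball 0 1"
    then have "norm (\<phi> x - \<phi> y) \<le> K * norm (x - y)" by (rule \<phi>_lip)
    also have "\<dots> \<le> (K + 1) * norm (x - y)" by (intro mult_right_mono) auto
    finally show "dist (\<phi> x) (\<phi> y) \<le> (K + 1) * dist x y" by (simp add: dist_norm)
  qed (use K0 in simp)
  have \<phi>_bd: "norm (\<phi> x) \<le> K" for x
  proof (cases "x \<in> ball 0 1")
    case True
    then have "norm (\<phi> x) \<le> K * norm x" using \<phi>_lip[OF True, of 0] \<phi>0 by simp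
    also have "\<dots> \<le> K" using True K0 by (simp add: mult_left_le)
    finally show ?thesis .
  qed (simp add: \<phi>_out K0)
  have "\<exists>D. bounded_clinear D \<and> (x \<in> ball 0 1 \<longrightarrow> (\<phi> has_derivative D) (at x)) \<and>
      (\<forall>w. norm (D w) \<le> (K + 1) * norm w)" for x
  proof (cases "x \<in> ball 0 1")
    case True
    then obtain D where "bounded_clinear D" "(\<phi> has_derivative D) (at x)"
      using hol unfolding cholomorphic_on_def by blast
    then show ?thesis using lipschitz_derivative_le[OF hol lip True] by blast
  next
    case False
    then show ?thesis using K0
      by (intro exI[of _ "\<lambda>_. 0"])
        (auto intro!: bounded_clinearI[where K = 0] simp: scaleC_complex_def)
  qed
  then obtain D where D: "\<And>x. bounded_clinear (D x)"
      "\<And>x. x \<in> ball 0 1 \<Longrightarrow> (\<phi> has_derivative D x) (at x)"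
      "\<And>x w. norm (D x w) \<le> (K + 1) * norm w"
    by metis
  have D_le: "norm (D x w) \<le> (K + 1) * r" if "norm w \<le> r" for x w r
    using D(3) by (rule order_trans) (use that K0 in \<open>auto intro: mult_left_mono\<close>)
  have D_diff: "D x (u - c *\<^sub>C v - w) = D x u - c * D x v - D x w" for x u c v w
    using linear_diff[OF bounded_linear.linear[OF bounded_clinear_imp_bounded_linear[OF D(1)]]]
      bounded_clinear_scaleC[OF D(1)] by (simp add: scaleC_complex_def)

  obtain F :: "('a cdual cdual \<Rightarrow> 'a) filter" where F: "F \<noteq> bot"
    "\<And>\<delta>. \<delta> > 0 \<Longrightarrow> \<forall>\<^sub>F T in F. \<forall>z. norm (T z) \<le> norm z + \<delta>"
    "\<And>c z w x. ((\<lambda>T. T (c *\<^sub>C z + w + bidual_embed x) - c *\<^sub>C T z - T w - x) \<longlongrightarrow> 0) F"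
    using almost_linear_retractions by blast
  obtain G where G: "G \<le> F" "G \<noteq> bot" and
    G_lim: "\<And>(\<psi> :: ('a cdual cdual \<Rightarrow> 'a) \<Rightarrow> complex) B.
      \<forall>\<^sub>F T in F. norm (\<psi> T) \<le> B \<Longrightarrow> \<exists>l. (\<psi> \<longlongrightarrow> l) G"
    using exists_finer_filter_with_limits[OF F(1)] by metis
  have T_norm: "\<forall>\<^sub>F T in G. \<forall>z. norm (T z) \<le> norm z + \<delta>" if "\<delta> > 0" for \<delta>
    using filter_leD[OF G(1) F(2)[OF that]] .
  have T_lin0: "((\<lambda>T. T (c *\<^sub>C z + w + bidual_embed x) - c *\<^sub>C T z - T w - x) \<longlongrightarrow> 0) G" for c z w x
    using tendsto_mono[OF G(1) F(3)] .
  have J0: "bidual_embed (0 :: 'a) = 0"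
    using linear_0[OF bounded_linear.linear[OF bounded_clinear_imp_bounded_linear[OF
          bounded_clinear_bidual_embed]]] .
  have T_lin: "((\<lambda>T. T (c *\<^sub>C z + w) - c *\<^sub>C T z - T w) \<longlongrightarrow> 0) G" for c z w
    using T_lin0[of c z w 0] by (simp add: J0)
  have T_add: "\<forall>\<^sub>F T in G. norm (T (z + w) - (T z + T w)) \<le> \<epsilon>" if "\<epsilon> > 0" for z w \<epsilon>
  proof -
    have "((\<lambda>T. T (z + w) - T z - T w) \<longlongrightarrow> 0) G"
      using T_lin[of 1 z w] by (simp add: scaleC_one)
    then show ?thesis
      using tendstoD[OF _ that] by (fastforce simp: algebra_simps elim!: eventually_mono)
  qed
  have T_ball: "\<forall>\<^sub>F T in G. T z \<in> ball 0 1" if "z \<in> ball 0 1" for z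
  proof -
    have "norm z + (1 - norm z) / 2 < 1" using that by (simp add: field_simps)
    then have "\<forall>\<^sub>F T in G. norm (T z) < 1"
      using that
      by (intro eventually_mono[OF T_norm[of "(1 - norm z) / 2"]]) (auto intro: le_less_trans)
    then show ?thesis by simp
  qed
  have T_dist: "\<forall>\<^sub>F T in G. norm (T z - T w) \<le> norm (z - w) + 2 * \<epsilon>" if "\<epsilon> > 0" for z w \<epsilon>
    using T_norm[OF that] T_add[OF that, of "z - w" w]
  proof eventually_elim
    case (elim T)
    have "norm (T z - T w) \<le> norm (T (z - w)) + norm (T z - (T (z - w) + T w))"
      using norm_triangle_ineq[of "T (z - w)" "T z - (T (z - w) + T w)"] by simp
    also have "\<dots> \<le> (norm (z - w) + \<epsilon>) + \<epsilon>"
      using elim by (intro add_mono) auto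
    finally show ?case by simp
  qed
  have T_embed: "((\<lambda>T. T (bidual_embed x)) \<longlongrightarrow> x) G" for x
  proof -
    have "((\<lambda>T. T 0) \<longlongrightarrow> 0) G"
    proof (rule tendstoI)
      fix e :: real assume "e > 0"
      then show "\<forall>\<^sub>F T in G. dist (T 0) 0 < e"
        by (intro eventually_mono[OF T_norm[of "e / 2"]]) (auto dest!: spec[of _ 0])
    qed
    then have "((\<lambda>T. (T (bidual_embed x) - T 0 - x) + T 0 + x) \<longlongrightarrow> 0 + 0 + x) G"
      using T_lin0[of 0 0 0 x] by (intro tendsto_add) (simp_all add: scaleC_zero_left)
    then show ?thesis by simp
  qed

  have "\<exists>l. ((\<lambda>T. \<phi> (T z)) \<longlongrightarrow> l) G" for z
    by (rule G_lim[of _ K]) (simp add: \<phi>_bd)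
  then obtain g where g: "\<And>z. ((\<lambda>T. \<phi> (T z)) \<longlongrightarrow> g z) G" by metis
  have "\<exists>l. ((\<lambda>T. D (T z) (T w)) \<longlongrightarrow> l) G" for z w
  proof (rule G_lim[of _ "(K + 1) * (norm w + 1)"])
    show "\<forall>\<^sub>F T in F. norm (D (T z) (T w)) \<le> (K + 1) * (norm w + 1)"
      using F(2)[OF zero_less_one]
    proof eventually_elim
      case (elim T)
      then show ?case by (intro D_le) blast
    qed
  qed
  then obtain E where E: "\<And>z w. ((\<lambda>T. D (T z) (T w)) \<longlongrightarrow> E z w) G" by metis

  \<comment> \<open>Bounds that hold along \<open>G\<close> up to an arbitrarily small error \<open>\<epsilon>\<close> hold for the limit without error.\<close>
  have le_lim: "norm l \<le> B 0" if "(\<psi> \<longlongrightarrow> l) G" "\<And>\<epsilon>. 0 < \<epsilon> \<Longrightarrow> \<epsilon> < r \<Longrightarrow> \<forall>\<^sub>F T in G. norm (\<psi> T) \<le> B \<epsilon>"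
      "isCont B 0" "0 < r" for \<psi> :: "_ \<Rightarrow> complex" and l and B :: "real \<Rightarrow> real" and r
  proof (rule tendsto_lowerbound)
    show "(B \<longlongrightarrow> B 0) (at_right 0)"
      using that(3) by (simp add: continuous_within filterlim_at_split)
    have "\<forall>\<^sub>F \<epsilon> in at_right 0. \<epsilon> > 0 \<and> \<epsilon> < r"
      using that(4) eventually_at_right_real by fastforce
    then show "\<forall>\<^sub>F \<epsilon> in at_right 0. norm l \<le> B \<epsilon>"
    proof eventually_elim
      case (elim \<epsilon>)
      then show ?case
        using tendsto_upperbound[OF tendsto_norm[OF that(1)] that(2)[of \<epsilon>] G(2)] by simp
    qed
  qed simp

  have g_lip: "norm (g z - g w) \<le> K * norm (z - w)" if zw: "z \<in> ball 0 1" "w \<in> ball 0 1" for z w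
  proof -
    have "norm (g z - g w) \<le> K * (norm (z - w) + 2 * 0)"
    proof (rule le_lim[where B = "\<lambda>\<epsilon>. K * (norm (z - w) + 2 * \<epsilon>)" and r = 1])
      show "((\<lambda>T. \<phi> (T z) - \<phi> (T w)) \<longlongrightarrow> g z - g w) G" by (intro tendsto_diff g)
      show "\<forall>\<^sub>F T in G. norm (\<phi> (T z) - \<phi> (T w)) \<le> K * (norm (z - w) + 2 * \<epsilon>)" if "\<epsilon> > 0" for \<epsilon>
        using T_ball[OF zw(1)] T_ball[OF zw(2)] T_dist[OF that, of z w]
      proof eventually_elim
        case (elim T)
        then show ?case
          using \<phi>_lip[of "T z" "T w"] mult_left_mono[OF elim(3) K0] by linarith
      qed
    qed (auto intro!: continuous_intros)
    then show ?thesis by simp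
  qed
  have g_embed: "g (bidual_embed x) = \<phi> x" if "x \<in> ball 0 1" for x
  proof (rule tendsto_unique[OF G(2) g])
    have "isCont \<phi> x" using D(2)[OF that] by (rule has_derivative_continuous)
    then show "((\<lambda>T. \<phi> (T (bidual_embed x))) \<longlongrightarrow> \<phi> x) G"
      by (rule isCont_tendsto_compose[OF _ T_embed])
  qed
  have E_clinear: "bounded_clinear (E z)" for z
  proof (rule bounded_clinearI[where K = "K + 1"])
    have E_lin: "E z (c *\<^sub>C v + w) = c * E z v + E z w" for c v w
    proof -
      have "((\<lambda>T. D (T z) (T (c *\<^sub>C v + w)) - c * D (T z) (T v) - D (T z) (T w))
          \<longlongrightarrow> E z (c *\<^sub>C v + w) - c * E z v - E z w) G"
        by (intro tendsto_intros E)
      moreover have "((\<lambda>T. D (T z) (T (c *\<^sub>C v + w)) - c * D (T z) (T v) - D (T z) (T w)) \<longlongrightarrow> 0) G"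
      proof (rule Lim_null_comparison)
        show "\<forall>\<^sub>F T in G. norm (D (T z) (T (c *\<^sub>C v + w)) - c * D (T z) (T v) - D (T z) (T w))
            \<le> (K + 1) * norm (T (c *\<^sub>C v + w) - c *\<^sub>C T v - T w)"
          using D(3) by (intro always_eventually allI) (simp flip: D_diff)
        show "((\<lambda>T. (K + 1) * norm (T (c *\<^sub>C v + w) - c *\<^sub>C T v - T w)) \<longlongrightarrow> 0) G"
          using tendsto_mult_right_zero[OF tendsto_norm_zero[OF T_lin]] .
      qed
      ultimately have "E z (c *\<^sub>C v + w) - c * E z v - E z w = 0"
        by (rule tendsto_unique[OF G(2)])
      then show ?thesis by (simp add: algebra_simps)
    qed
    show add: "E z (v + w) = E z v + E z w" for v w
      using E_lin[of 1 v w] by (simp add: scaleC_one)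
    show "E z (c *\<^sub>C v) = c *\<^sub>C E z v" for c v
      using E_lin[of c v 0] add[of 0 0] by (simp add: scaleC_complex_def)
    show "norm (E z w) \<le> (K + 1) * norm w" for w
    proof -
      have "norm (E z w) \<le> (K + 1) * (norm w + 0)"
      proof (rule le_lim[where B = "\<lambda>\<epsilon>. (K + 1) * (norm w + \<epsilon>)" and r = 1, OF E])
        show "\<forall>\<^sub>F T in G. norm (D (T z) (T w)) \<le> (K + 1) * (norm w + \<epsilon>)" if "\<epsilon> > 0" for \<epsilon>
          using T_norm[OF that]
        proof eventually_elim
          case (elim T)
          then show ?case by (intro D_le) blast
        qed
      qed (auto intro!: continuous_intros)
      then show ?thesis by simp
    qed
  qed
  have g_deriv: "(g has_derivative E z) (at z)" if z: "z \<in> ball 0 1" for z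
  proof -
    \<comment> \<open>Along \<open>G\<close> the points \<open>T z\<close> keep at least the distance \<open>d\<close> from the unit sphere.\<close>
    define d where "d = (1 - norm z) / 2"
    have d: "2 * d = 1 - norm z" "d > 0" using z by (simp_all add: d_def)
    show ?thesis
    proof (rule has_derivative_of_quadratic_error)
    let ?C = "4 * (K + 1) / d"
    show "bounded_linear (E z)" by (rule bounded_clinear_imp_bounded_linear[OF E_clinear])
    show "0 < d" by (rule d(2))
    fix w :: "'a cdual cdual" assume w: "norm w < d"
    have "norm (z + w) < 1" using norm_triangle_ineq[of z w] w d by linarith
    then have zw: "z + w \<in> ball 0 1" by simp
    have "norm (g (z + w) - g z - E z w) \<le> 4 * (K + 1) * (norm w + 0)\<^sup>2 / d + (K + 1) * 0"
    proof (rule le_lim[where B = "\<lambda>\<epsilon>. 4 * (K + 1) * (norm w + \<epsilon>)\<^sup>2 / d + (K + 1) * \<epsilon>"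
            and r = "d - norm w"])
      show "((\<lambda>T. \<phi> (T (z + w)) - \<phi> (T z) - D (T z) (T w)) \<longlongrightarrow> g (z + w) - g z - E z w) G"
        by (intro tendsto_diff g E)
      fix \<epsilon> :: real assume \<epsilon>: "0 < \<epsilon>" "\<epsilon> < d - norm w"
      show "\<forall>\<^sub>F T in G. norm (\<phi> (T (z + w)) - \<phi> (T z) - D (T z) (T w))
          \<le> 4 * (K + 1) * (norm w + \<epsilon>)\<^sup>2 / d + (K + 1) * \<epsilon>"
        using T_norm[OF \<epsilon>(1)] T_add[OF \<epsilon>(1), of z w] T_ball[OF zw]
      proof eventually_elim
        case (elim T)
        have Tw: "norm (T w) \<le> norm w + \<epsilon>" using elim(1) by blast
        have "norm (T z) \<le> norm z + \<epsilon>" using elim(1) by blast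
        then have Tz: "norm (T z) \<le> 1 - d" using \<epsilon>(2) d norm_ge_zero[of w] by linarith
        have sum: "norm (T z) + norm (T w) < 1" using Tw Tz \<epsilon>(2) by linarith
        have in_ball: "T z \<in> ball 0 1" "T z + T w \<in> ball 0 1"
          using sum norm_triangle_ineq[of "T z" "T w"] norm_ge_zero[of "T w"]
          by (simp_all del: norm_ge_zero)
        have "norm (\<phi> (T z + T w) - \<phi> (T z) - D (T z) (T w))
            \<le> 4 * (K + 1) * (norm (T w))\<^sup>2 / (1 - norm (T z))"
          using lipschitz_first_order_error_ball[OF hol lip _ D(1) D(2)[OF in_ball(1)] sum] K0 by simp
        also have "\<dots> \<le> 4 * (K + 1) * (norm w + \<epsilon>)\<^sup>2 / d"
          using Tw Tz K0 d by (intro frac_le mult_left_mono power_mono) auto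
        finally have 1: "norm (\<phi> (T z + T w) - \<phi> (T z) - D (T z) (T w))
            \<le> 4 * (K + 1) * (norm w + \<epsilon>)\<^sup>2 / d" .
        have "norm (\<phi> (T (z + w)) - \<phi> (T z + T w)) \<le> (K + 1) * norm (T (z + w) - (T z + T w))"
          using lipschitz_onD[OF lip elim(3) in_ball(2)] by (simp add: dist_norm)
        also have "\<dots> \<le> (K + 1) * \<epsilon>" using elim(2) K0 by (intro mult_left_mono) auto
        finally have 2: "norm (\<phi> (T (z + w)) - \<phi> (T z + T w)) \<le> (K + 1) * \<epsilon>" .
        have "norm (\<phi> (T (z + w)) - \<phi> (T z) - D (T z) (T w))
          \<le> norm (\<phi> (T z + T w) - \<phi> (T z) - D (T z) (T w)) + norm (\<phi> (T (z + w)) - \<phi> (T z + T w))"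
          using norm_triangle_ineq[of "\<phi> (T z + T w) - \<phi> (T z) - D (T z) (T w)"
              "\<phi> (T (z + w)) - \<phi> (T z + T w)"] by (simp add: algebra_simps)
        then show ?case using 1 2 by linarith
      qed
    qed (use w d in \<open>auto intro!: continuous_intros\<close>)
    then show "norm (g (z + w) - g z - E z w) \<le> ?C * (norm w)\<^sup>2" by simp
  qed
  qed

  define g' where "g' z = (if z \<in> ball 0 1 then g z else 0)" for z
  have "(g' has_derivative E z) (at z)" if "z \<in> ball 0 1" for z
    using g_deriv[OF that] by (rule has_derivative_transform_within_open[of _ _ _ _ "ball 0 1"])
      (use that in \<open>auto simp: g'_def\<close>)
  then have "cholomorphic_on g' (ball 0 1)"
    unfolding cholomorphic_on_def using E_clinear by blast
  moreover have "K-lipschitz_on (ball 0 1) g'"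
    by (rule lipschitz_onI) (use g_lip K0 in \<open>auto simp: g'_def dist_norm\<close>)
  moreover have "g' 0 = 0" using g_embed[of 0] \<phi>0 by (simp add: g'_def J0)
  ultimately have g'_mem: "hl0_apply (Abs_hl0 g') = g'"
    by (intro Abs_hl0_inverse) (auto simp: g'_def)
  show ?thesis
  proof
    have "hl0_apply (hl0_restrict (Abs_hl0 g')) = \<phi>"
      unfolding hl0_restrict.rep_eq g'_mem
      using bidual_embed_in_ball g_embed \<phi>_out by (fastforce simp: g'_def)
    then show "hl0_restrict (Abs_hl0 g') = f" by (simp add: \<phi>_def hl0_apply_inject)
    have "lip_const g' \<le> K"
      by (rule lip_const_least[OF K0]) (use g_lip in \<open>auto simp: g'_def\<close>)
    then show "norm (Abs_hl0 g') \<le> norm f"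
      by (simp add: norm_hl0.rep_eq g'_mem K_def)
  qed
qed

section \<open>The map \<open>rho\<close>\<close>

text \<open>The map \<open>rho\<close> is the transpose of the restriction map, and restriction sends the unit ball onto the
unit ball by the extension theorem.\<close>

theorem norm_rho:
  fixes \<phi> :: "'a::complex_normed_vector hl0 cdual"
  shows "norm (rho \<phi>) = norm \<phi>"
proof (rule antisym)
  show "norm (rho \<phi>) \<le> norm \<phi>"
  proof (rule norm_cdual_le)
    show "norm (cdual_apply (rho \<phi>) g) \<le> norm \<phi> * norm g" for g
      using norm_cdual_apply_le[of \<phi> "hl0_restrict g"]
        mult_left_mono[OF norm_hl0_restrict_le[of g], of "norm \<phi>"]
      by (simp add: cdual_apply_rho)
  qed simp
  show "norm \<phi> \<le> norm (rho \<phi>)"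
  proof (rule norm_cdual_le)
    fix f :: "'a hl0"
    obtain g :: "'a cdual cdual hl0" where g: "hl0_restrict g = f" "norm g \<le> norm f"
      by (rule hl0_norm_preserving_extension)
    show "norm (cdual_apply \<phi> f) \<le> norm (rho \<phi>) * norm f"
      using norm_cdual_apply_le[of "rho \<phi>" g] mult_left_mono[OF g(2), of "norm (rho \<phi>)"]
      by (simp add: cdual_apply_rho g(1))
  qed simp
qed

lemma topspace_compact_open: "topspace compact_open = UNIV"
proof -
  have "openin compact_open UNIV"
    unfolding openin_compact_open by (auto intro!: exI[of _ "{}"] exI[of _ "1::real"])
  then show ?thesis using openin_subset by blast
qed

lemma continuous_on_bidual_embed: "continuous_on A bidual_embed"
  by (rule bounded_linear.continuous_on[OF bounded_clinear_imp_bounded_linear[OF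
        bounded_clinear_bidual_embed] continuous_on_id])

text \<open>The canonical embedding maps compact subsets of \<open>B\<^sub>X\<close> to compact subsets of the larger ball.\<close>

lemma continuous_map_hl0_restrict:
  "continuous_map compact_open compact_open
    (hl0_restrict :: 'a::complex_normed_vector cdual cdual hl0 \<Rightarrow> 'a hl0)"
proof -
  have "openin compact_open {g :: 'a cdual cdual hl0. hl0_restrict g \<in> W}"
    if W: "openin compact_open W" for W
    unfolding openin_compact_open
  proof
    fix g :: "'a cdual cdual hl0" assume "g \<in> {g. hl0_restrict g \<in> W}"
    then have "hl0_restrict g \<in> W" by simp
    from W[unfolded openin_compact_open, rule_format, OF this]
    obtain K e where K: "compact K" "K \<subseteq> ball 0 1" "e > 0"
      and sub: "{h. \<forall>x\<in>K. norm (hl0_apply h x - hl0_apply (hl0_restrict g) x) < e} \<subseteq> W"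
      by blast
    have restrict: "hl0_apply (hl0_restrict h) x = hl0_apply h (bidual_embed x)" if "x \<in> K"
      for h :: "'a cdual cdual hl0" and x
      using that K(2) by (auto simp: hl0_restrict.rep_eq)
    show "\<exists>K e. compact K \<and> K \<subseteq> ball 0 1 \<and> e > 0 \<and>
        {h. \<forall>x\<in>K. norm (hl0_apply h x - hl0_apply g x) < e} \<subseteq> {g. hl0_restrict g \<in> W}"
    proof (intro exI conjI)
      show "compact (bidual_embed ` K)"
        by (rule compact_continuous_image[OF continuous_on_bidual_embed K(1)])
      show "bidual_embed ` K \<subseteq> ball 0 1"
        using K(2) bidual_embed_in_ball by blast
      show "{h. \<forall>x\<in>bidual_embed ` K. norm (hl0_apply h x - hl0_apply g x) < e}
          \<subseteq> {g. hl0_restrict g \<in> W}"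
      proof
        fix h assume "h \<in> {h. \<forall>x\<in>bidual_embed ` K. norm (hl0_apply h x - hl0_apply g x) < e}"
        then have "hl0_restrict h \<in> {h. \<forall>x\<in>K. norm (hl0_apply h x - hl0_apply (hl0_restrict g) x) < e}"
          by (simp add: restrict)
        then show "h \<in> {g. hl0_restrict g \<in> W}" using sub by blast
      qed
    qed (rule K(3))
  qed
  then show ?thesis by (simp add: continuous_map_def topspace_compact_open)
qed

lemma rho_in_G0: "\<phi> \<in> G0 \<Longrightarrow> rho \<phi> \<in> G0"
proof -
  assume "\<phi> \<in> G0"
  then have \<phi>: "continuous_map (subtopology compact_open {f. norm f \<le> 1}) euclidean (cdual_apply \<phi>)"
    by (simp add: G0_def)
  have "continuous_map (subtopology compact_open {g. norm g \<le> 1})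
      (subtopology compact_open {f. norm f \<le> 1}) hl0_restrict"
  proof (rule continuous_map_into_subtopology)
    show "continuous_map (subtopology compact_open {g. norm g \<le> 1}) compact_open hl0_restrict"
      by (rule continuous_map_from_subtopology[OF continuous_map_hl0_restrict])
    show "hl0_restrict \<in> topspace (subtopology compact_open {g. norm g \<le> 1}) \<rightarrow> {f. norm f \<le> 1}"
      by (auto intro: order_trans[OF norm_hl0_restrict_le])
  qed
  from continuous_map_compose[OF this \<phi>] show "rho \<phi> \<in> G0"
    by (simp only: G0_def o_def cdual_apply_rho[symmetric] mem_Collect_eq)
qed

lemma rho_add: "rho (\<phi> + \<psi>) = rho \<phi> + rho \<psi>"
  by transfer simp

lemma rho_scaleC: "rho (c *\<^sub>C \<phi>) = c *\<^sub>C rho \<phi>"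
  by transfer simp

theorem corollary4p5:
  assumes "symmetrically_regular TYPE('a::complex_banach)"
  shows "rho ` (G0 :: 'a hl0 cdual set) \<subseteq> (G0 :: 'a cdual cdual hl0 cdual set)
    \<and> (\<forall>\<phi>\<in>(G0 :: 'a hl0 cdual set). \<forall>\<psi>\<in>G0. rho (\<phi> + \<psi>) = rho \<phi> + rho \<psi>)
    \<and> (\<forall>c. \<forall>\<phi>\<in>(G0 :: 'a hl0 cdual set). rho (c *\<^sub>C \<phi>) = c *\<^sub>C rho \<phi>)
    \<and> (\<forall>\<phi>\<in>(G0 :: 'a hl0 cdual set). norm (rho \<phi>) = norm \<phi>)"
  by (auto simp: rho_add rho_scaleC norm_rho intro: rho_in_G0)

end
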